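(* Let $G$ be a finite group, and let $N$ be a normal subgroup of $G$. Then the following are equivalent: (1) There is a normal subgroup $M$ of $G$ with $N < M$ (proper containment) and an element $g \in M \setminus N$ such that $g^G = M \setminus N$ and $|\mathrm{Irr}(G/N \mid M/N)| = 1$. (2) There is an element $g \in G \setminus N$, and $\chi \in \mathrm{Irr}(G)$ with $N \le \ker\chi$, such that $\chi$ vanishes on all of the $G$-conjugacy classes contained in $G \setminus N$ except $g^G$, and every character in $\mathrm{Irr}(G \mid N)$ vanishes on $g$. (3) There is a normal subgroup $M$ of $G$ with $N < M$ (proper containment), and a unique $\chi \in \mathrm{Irr}(G)$ that does not vanish on $M \setminus N$ and does not have the elements of $M \setminus N$ in its kernel.
   Context: All groups are finite and characters are complex. $g^G$ is the conjugacy class of $g$ in $G$. $\mathrm{Irr}(G)$ is the set of irreducible complex characters of $G$; for a normal subgroup $N$ of $G$, $\mathrm{Irr}(G\mid N)$ is the set of $\chi\in\mathrm{Irr}(G)$ whose kernel does not contain $N$; so $\mathrm{Irr}(G/N\mid M/N)$ is the set of irreducible characters of $G/N$ whose kernel does not contain $M/N$. Characters of $G/N$ are identified by inflation with characters of $G$ having $N$ in their kernel. A character "vanishes on" a set if it takes the value $0$ at every element of the set; in (3), the two requirements on $\chi$ are that $\chi$ is not identically zero on $M\setminus N$ and that $M\setminus N\not\subseteq\ker\chi$. *)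

theory Defs
  imports "Jordan_Normal_Form.VS_Connect" "HOL-Algebra.Algebra"
begin

definition mat_trace :: "'a::comm_monoid_add mat \<Rightarrow> 'a" where
  "mat_trace A = (\<Sum>i<dim_row A. A $$ (i, i))"

text \<open>The units of the ring of complex \<open>n \<times> n\<close> matrices form \<open>GL\<^sub>n\<close>.\<close>

definition representation ::
    "('a, 'b) monoid_scheme \<Rightarrow> nat \<Rightarrow> ('a \<Rightarrow> complex mat) \<Rightarrow> bool" where
  "representation G n \<rho> \<longleftrightarrow> \<rho> \<in> hom G (units_of (ring_mat TYPE(complex) n ()))"

definition irreducible_representation ::
    "('a, 'b) monoid_scheme \<Rightarrow> nat \<Rightarrow> ('a \<Rightarrow> complex mat) \<Rightarrow> bool" where
  "irreducible_representation G n \<rho> \<longleftrightarrow>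
     representation G n \<rho> \<and> n > 0 \<and>
     (\<forall>W. VectorSpace.subspace class_ring W (module_vec TYPE(complex) n) \<and>
          (\<forall>g\<in>carrier G. \<forall>w\<in>W. \<rho> g *\<^sub>v w \<in> W)
        \<longrightarrow> W = {0\<^sub>v n} \<or> W = carrier_vec n)"

text \<open>Restricting to the carrier makes distinct characters correspond to distinct functions
  on the group, so that characters can be counted.\<close>

definition rep_character ::
    "('a, 'b) monoid_scheme \<Rightarrow> ('a \<Rightarrow> complex mat) \<Rightarrow> 'a \<Rightarrow> complex" where
  "rep_character G \<rho> = (\<lambda>g\<in>carrier G. mat_trace (\<rho> g))"

definition Irr :: "('a, 'b) monoid_scheme \<Rightarrow> ('a \<Rightarrow> complex) set" where
  "Irr G = {rep_character G \<rho> | n \<rho>. irreducible_representation G n \<rho>}"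

text \<open>This is the usual definition of the kernel of a character; for a character of a finite
  group it is the kernel of any representation affording it.\<close>

definition char_ker :: "('a, 'b) monoid_scheme \<Rightarrow> ('a \<Rightarrow> complex) \<Rightarrow> 'a set" where
  "char_ker G \<chi> = {g \<in> carrier G. \<chi> g = \<chi> \<one>\<^bsub>G\<^esub>}"

definition Irr_rel :: "('a, 'b) monoid_scheme \<Rightarrow> 'a set \<Rightarrow> ('a \<Rightarrow> complex) set" where
  "Irr_rel G N = {\<chi> \<in> Irr G. \<not> N \<subseteq> char_ker G \<chi>}"

definition conj_class :: "('a, 'b) monoid_scheme \<Rightarrow> 'a \<Rightarrow> 'a set" where
  "conj_class G g = {x \<otimes>\<^bsub>G\<^esub> g \<otimes>\<^bsub>G\<^esub> inv\<^bsub>G\<^esub> x | x. x \<in> carrier G}"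

definition vanishes_on :: "('a \<Rightarrow> complex) \<Rightarrow> 'a set \<Rightarrow> bool" where
  "vanishes_on \<chi> S \<longleftrightarrow> (\<forall>x\<in>S. \<chi> x = 0)"

end

theory Submission
  imports Defs "Jordan_Normal_Form.Schur_Decomposition"
begin

text \<open>
  Call an irreducible character of \<open>G\<close> a character between the normal subgroups \<open>N\<close> and \<open>M\<close> if its
  kernel contains \<open>N\<close> but not \<open>M\<close>. Inflation identifies these characters with the irreducible
  characters of \<open>G/N\<close> whose kernel does not contain \<open>M/N\<close> (\<open>card_Irr_rel_quotient\<close>), so the first
  condition asks for some \<open>M\<close> such that \<open>M - N\<close> is a single conjugacy class and there is exactly
  one character \<open>\<chi>\<close> between \<open>N\<close> and \<open>M\<close>.

  Two facts do most of the work. The sum of an irreducible character over a coset of a normal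
  subgroup \<open>N\<close> is \<open>0\<close> unless \<open>N\<close> lies in its kernel (\<open>normal_coset_sum_eq_0\<close>), and a class function
  orthogonal to all irreducible characters is \<open>0\<close> (\<open>orthogonal_class_function\<close>). Testing a suitable
  combination of \<open>\<chi>\<close> and the indicators of \<open>N\<close> and \<open>M\<close> against all irreducible characters shows that a
  character \<open>\<chi>\<close> which is the only one between \<open>N\<close> and \<open>M\<close> satisfies
  \<open>\<chi>(\<one>) \<chi> = |G|/|N| 1\<^sub>N - |G|/|M| 1\<^sub>M\<close> (\<open>unique_irr_between_values\<close>). Thus \<open>\<chi>\<close> vanishes outside \<open>M\<close> and
  nowhere on \<open>M - N\<close>.

  The first condition therefore implies the vanishing of \<open>\<chi>\<close> required in the second. Moreover, if
  \<open>M - N\<close> is the class of \<open>g\<close>, it contains the coset \<open>gN\<close>, so a character whose kernel does not contain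
  \<open>N\<close> is constant on \<open>gN\<close> with sum \<open>0\<close>, that is, it vanishes at \<open>g\<close>. This settles the second
  condition and also the uniqueness in the third.

  Conversely, suppose that \<open>\<chi>\<close> vanishes on \<open>G - N\<close> except on the class of \<open>g\<close>. A nontrivial
  such \<open>\<chi>\<close> exists: if the trivial character has this property, then so has every other one, as
  \<open>G - N\<close> is then the class of \<open>g\<close>. The orthogonality
  relations of \<open>\<chi>\<close> with the other irreducible characters of \<open>G/N\<close> have contributions from \<open>N\<close> and from
  the class of \<open>g\<close> only, and comparison with the trivial character forces \<open>g\<close> into the kernels of all
  the others. The intersection \<open>M\<close> of these kernels has \<open>\<chi>\<close> as its only character between \<open>N\<close> and
  \<open>M\<close>, and by the formula \<open>M - N\<close> is contained in the class of \<open>g\<close>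
  (\<open>single_class_of_vanishing_character\<close>).

  Finally, suppose that \<open>\<chi>\<close> is unique in the third condition. All other irreducible characters are
  constant on \<open>M - N\<close>. A combination of two class indicators in \<open>M - N\<close> that is orthogonal to them is a
  multiple of the conjugate of \<open>\<chi>\<close>, and since it vanishes at \<open>\<one>\<close> it is \<open>0\<close>; hence \<open>M - N\<close> is
  one class (\<open>single_class_of_unique_character\<close>).
\<close>

section \<open>Subspaces and injective matrices\<close>

text \<open>The closure conditions are spelled out so that subspaces of \<open>\<complex>\<^sup>n\<close> can be handled as plain
  sets of vectors; the next lemma identifies them with the subspaces of the module
  \<open>module_vec\<close>.\<close>

definition vec_subspace :: "nat \<Rightarrow> complex vec set \<Rightarrow> bool" where
  "vec_subspace n W \<longleftrightarrow> W \<subseteq> carrier_vec n \<and> 0\<^sub>v n \<in> W \<and>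
     (\<forall>v\<in>W. \<forall>w\<in>W. v + w \<in> W) \<and> (\<forall>c. \<forall>v\<in>W. c \<cdot>\<^sub>v v \<in> W)"

lemma subspace_iff_lin_sub:
  "VectorSpace.subspace class_ring W (module_vec TYPE(complex) n) \<longleftrightarrow> vec_subspace n W"
proof
  assume "VectorSpace.subspace class_ring W (module_vec TYPE(complex) n)"
  then have "submodule class_ring W (module_vec TYPE(complex) n)"
    by (simp add: VectorSpace.subspace_def)
  then show "vec_subspace n W"
    unfolding vec_subspace_def submodule_def module_vec_simps by auto
next
  assume "vec_subspace n W"
  then show "VectorSpace.subspace class_ring W (module_vec TYPE(complex) n)"
    unfolding vec_subspace_def VectorSpace.subspace_def submodule_def module_vec_simps
    using vec_vs[of n, where ?'a=complex] vec_module[of n, where ?'a=complex] by auto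
qed

definition injective_mat :: "complex mat \<Rightarrow> bool" where
  "injective_mat C \<longleftrightarrow> (\<forall>v\<in>carrier_vec (dim_col C). C *\<^sub>v v = 0\<^sub>v (dim_row C) \<longrightarrow> v = 0\<^sub>v (dim_col C))"

lemma injective_matD:
  assumes "injective_mat C" "C \<in> carrier_mat n r" "v \<in> carrier_vec r" "C *\<^sub>v v = 0\<^sub>v n"
  shows "v = 0\<^sub>v r"
  using assms unfolding injective_mat_def by auto

lemma injective_mat_square_surj:
  assumes C: "C \<in> carrier_mat n n" and inj: "injective_mat C" and w: "w \<in> carrier_vec n"
  shows "\<exists>v\<in>carrier_vec n. C *\<^sub>v v = w"
proof -
  have "det C \<noteq> 0"
    using det_0_iff_vec_prod_zero[OF C] injective_matD[OF inj C] by blast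
  then have "C \<in> Units (ring_mat TYPE(complex) n ())"
    using det_non_zero_imp_unit[OF C, of "()"] by blast
  then obtain D where D: "D \<in> carrier_mat n n" and CD: "C * D = 1\<^sub>m n"
    unfolding Units_def by (auto simp: ring_mat_simps)
  have "C *\<^sub>v (D *\<^sub>v w) = w"
    using assoc_mult_mat_vec[OF C D w] CD w by simp
  then show ?thesis using D w by (intro bexI[of _ "D *\<^sub>v w"]) auto
qed

text \<open>If \<open>r > n\<close>, padding \<open>C\<close> with zero rows would give an injective square matrix. It would be
  surjective, yet every vector in its image has last entry \<open>0\<close>.\<close>

lemma injective_mat_le:
  assumes C: "C \<in> carrier_mat n r" and inj: "injective_mat C"
  shows "r \<le> n"
proof (rule ccontr)
  assume "\<not> r \<le> n"
  then have nr: "n < r" by simp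
  define A where "A = mat r r (\<lambda>(i,j). if i < n then C $$ (i,j) else 0)"
  have A: "A \<in> carrier_mat r r" unfolding A_def by simp
  have Arow: "row A (r - 1) = 0\<^sub>v r" using nr unfolding A_def by (intro eq_vecI) auto
  have nosurj: "\<not> (\<exists>v\<in>carrier_vec r. A *\<^sub>v v = unit_vec r (r - 1))"
  proof
    assume "\<exists>v\<in>carrier_vec r. A *\<^sub>v v = unit_vec r (r - 1)"
    then obtain v where v: "v \<in> carrier_vec r" "A *\<^sub>v v = unit_vec r (r - 1)" by blast
    have "(A *\<^sub>v v) $ (r - 1) = row A (r - 1) \<bullet> v" using nr A by simp
    then show False using v Arow nr by simp
  qed
  have "injective_mat A"
    unfolding injective_mat_def
  proof (intro ballI impI)
    fix v assume v: "v \<in> carrier_vec (dim_col A)" and Av: "A *\<^sub>v v = 0\<^sub>v (dim_row A)"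
    have v': "v \<in> carrier_vec r" using v A by simp
    have "C *\<^sub>v v = 0\<^sub>v n"
    proof (rule eq_vecI)
      fix i assume i: "i < dim_vec (0\<^sub>v n :: complex vec)"
      then have "row A i = row C i" using C nr unfolding A_def by (intro eq_vecI) auto
      moreover have "(A *\<^sub>v v) $ i = 0" using Av i nr A by simp
      ultimately show "(C *\<^sub>v v) $ i = 0\<^sub>v n $ i" using i C A nr by simp
    qed (use C in simp)
    then show "v = 0\<^sub>v (dim_col A)" using injective_matD[OF inj C v'] A by simp
  qed
  from injective_mat_square_surj[OF A this, of "unit_vec r (r - 1)"] nosurj show False by simp
qed

text \<open>Among the injective matrices with columns in \<open>W\<close>, take one with the largest number of columns,
  which is at most \<open>n\<close>. Its image is \<open>W\<close>: a vector of \<open>W\<close> outside the image could be appended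
  as a further column without losing injectivity.\<close>

lemma subspace_basis:
  assumes W: "vec_subspace n W"
  obtains r C where "C \<in> carrier_mat n r" "injective_mat C" "{C *\<^sub>v v | v. v \<in> carrier_vec r} = W"
proof -
  define P where "P r \<longleftrightarrow> (\<exists>C \<in> carrier_mat n r. injective_mat C \<and> (\<forall>v\<in>carrier_vec r. C *\<^sub>v v \<in> W))" for r
  have Wc: "W \<subseteq> carrier_vec n" and W0: "0\<^sub>v n \<in> W"
    and Wa: "\<And>v w. v \<in> W \<Longrightarrow> w \<in> W \<Longrightarrow> v + w \<in> W" and Ws: "\<And>c v. v \<in> W \<Longrightarrow> c \<cdot>\<^sub>v v \<in> W"
    using W unfolding vec_subspace_def by auto
  have P0: "P 0"
    unfolding P_def
  proof (intro bexI[of _ "0\<^sub>m n 0"] conjI ballI)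
    show "injective_mat (0\<^sub>m n 0)" unfolding injective_mat_def by auto
    fix v :: "complex vec" assume "v \<in> carrier_vec 0"
    then have "0\<^sub>m n 0 *\<^sub>v v = 0\<^sub>v n" by (intro eq_vecI) (auto simp: scalar_prod_def)
    then show "0\<^sub>m n 0 *\<^sub>v v \<in> W" using W0 by simp
  qed simp
  have bd: "r \<le> n" if "P r" for r using that injective_mat_le unfolding P_def by blast
  define r where "r = (GREATEST r. P r)"
  have Pr: "P r" unfolding r_def by (rule GreatestI_nat[of P, OF P0 bd])
  have nP: "\<not> P (Suc r)"
    using Greatest_le_nat[of P "Suc r" n, OF _ bd] unfolding r_def by force
  from Pr obtain C where C: "C \<in> carrier_mat n r" and inj: "injective_mat C"
    and img: "\<And>v. v\<in>carrier_vec r \<Longrightarrow> C *\<^sub>v v \<in> W" unfolding P_def by blast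
  have "w \<in> {C *\<^sub>v v | v. v \<in> carrier_vec r}" if w: "w \<in> W" for w
  proof (rule ccontr)
    assume notin: "w \<notin> {C *\<^sub>v v | v. v \<in> carrier_vec r}"
    have wc: "w \<in> carrier_vec n" using w Wc by auto
    \<comment> \<open>\<open>D\<close> is \<open>C\<close> with \<open>w\<close> appended as its last column.\<close>
    define D where "D = mat n (Suc r) (\<lambda>(i,j). if j < r then C $$ (i,j) else w $ i)"
    have D: "D \<in> carrier_mat n (Suc r)" unfolding D_def by simp
    have Dv: "D *\<^sub>v v = C *\<^sub>v vec r (\<lambda>i. v $ i) + v $ r \<cdot>\<^sub>v w" if v: "v \<in> carrier_vec (Suc r)" for v
      using v C wc unfolding D_def
      by (intro eq_vecI) (auto simp: scalar_prod_def)
    have "P (Suc r)" unfolding P_def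
    proof (intro bexI[OF _ D] conjI ballI)
      fix v :: "complex vec" assume v: "v \<in> carrier_vec (Suc r)"
      show "D *\<^sub>v v \<in> W" unfolding Dv[OF v] by (intro Wa img Ws w) simp
    next
      show "injective_mat D" unfolding injective_mat_def
      proof (intro ballI impI)
        fix v assume "v \<in> carrier_vec (dim_col D)" and D0': "D *\<^sub>v v = 0\<^sub>v (dim_row D)"
        then have v: "v \<in> carrier_vec (Suc r)" and D0: "D *\<^sub>v v = 0\<^sub>v n" using D by auto
        define u where "u = vec r (\<lambda>i. v $ i)"
        have u: "u \<in> carrier_vec r" unfolding u_def by simp
        have Cu: "C *\<^sub>v u \<in> carrier_vec n" using C u by simp
        have eq: "C *\<^sub>v u + v $ r \<cdot>\<^sub>v w = 0\<^sub>v n" using D0 Dv[OF v] u_def by simp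
        have vr: "v $ r = 0"
        proof (rule ccontr)
          assume ne: "v $ r \<noteq> 0"
          have "C *\<^sub>v ((- inverse (v $ r)) \<cdot>\<^sub>v u) = (- inverse (v $ r)) \<cdot>\<^sub>v (C *\<^sub>v u)"
            using mult_mat_vec[OF C u] by simp
          also have "\<dots> = w"
          proof (rule eq_vecI)
            fix i assume i: "i < dim_vec w"
            have i': "i < n" using i wc by simp
            have "(C *\<^sub>v u + v $ r \<cdot>\<^sub>v w) $ i = 0" using eq i' by simp
            then have "(C *\<^sub>v u) $ i = - (v $ r * w $ i)" using i' wc Cu C by (simp add: eq_neg_iff_add_eq_0)
            then show "((- inverse (v $ r)) \<cdot>\<^sub>v (C *\<^sub>v u)) $ i = w $ i"
              using i' ne C by (simp add: field_simps)
          qed (use wc C in simp)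
          finally show False using notin u by (auto intro!: exI[of _ "(- inverse (v $ r)) \<cdot>\<^sub>v u"])
        qed
        have "v $ r \<cdot>\<^sub>v w = 0\<^sub>v n" using vr wc by (intro eq_vecI) auto
        then have "C *\<^sub>v u = 0\<^sub>v n" using Cu eq Cu by simp
        then have "u = 0\<^sub>v r" using injective_matD[OF inj C u] by simp
        then have "v $ i = 0" if "i < Suc r" for i
        proof (cases "i = r")
          case False
          then have "u $ i = v $ i" using that unfolding u_def by simp
          then show ?thesis using \<open>u = 0\<^sub>v r\<close> False that by simp
        qed (use vr in simp)
        then show "v = 0\<^sub>v (dim_col D)" using v D by (intro eq_vecI) auto
      qed
    qed
    then show False using nP by simp
  qed
  then have "{C *\<^sub>v v | v. v \<in> carrier_vec r} = W" using img by blast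
  then show thesis using that C inj by blast
qed

lemma subspace_basis_dim_pos:
  assumes C: "(C :: complex mat) \<in> carrier_mat n r" and img: "{C *\<^sub>v v | v. v \<in> carrier_vec r} = W"
    and ne: "W \<noteq> {0\<^sub>v n}"
  shows "r > (0::nat)"
proof (rule ccontr)
  assume "\<not> r > 0"
  then have "C *\<^sub>v v = 0\<^sub>v n" if "v \<in> carrier_vec r" for v :: "complex vec"
    using that C by (intro eq_vecI) (auto simp: scalar_prod_def)
  moreover have "(0\<^sub>v r :: complex vec) \<in> carrier_vec r" by simp
  ultimately have "{C *\<^sub>v v | v. v \<in> carrier_vec r} = {0\<^sub>v n}"
    by (intro equalityI subsetI) (auto simp del: carrier_vec_dim_vec intro!: exI[of _ "0\<^sub>v r"])
  then show False using img ne by simp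
qed

text \<open>With \<open>C\<close> read as a basis of the invariant subspace \<open>W\<close>, the matrix \<open>B\<close> is that of \<open>A\<close> restricted
  to \<open>W\<close>.\<close>

lemma invariant_restrict:
  assumes C: "(C :: complex mat) \<in> carrier_mat n r" and img: "{C *\<^sub>v v | v. v \<in> carrier_vec r} = W"
    and A: "A \<in> carrier_mat n n" and inv: "\<And>w. w \<in> W \<Longrightarrow> A *\<^sub>v w \<in> W"
  shows "\<exists>B\<in>carrier_mat r r. A * C = C * B"
proof -
  have "\<exists>v\<in>carrier_vec r. C *\<^sub>v v = A *\<^sub>v col C j" if j: "j < r" for j
  proof -
      have "col C j = C *\<^sub>v unit_vec r j" using C j by (intro eq_vecI) auto
    then have "col C j \<in> W" using img j by (auto intro!: exI[of _ "unit_vec r j"])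
    from inv[OF this] show ?thesis using img by force
  qed
  then obtain f where f: "\<And>j. j < r \<Longrightarrow> f j \<in> carrier_vec r \<and> C *\<^sub>v f j = A *\<^sub>v col C j" by metis
  define B where "B = mat r r (\<lambda>(i,j). f j $ i)"
  have B: "B \<in> carrier_mat r r" unfolding B_def by simp
  have colB: "col B j = f j" if "j < r" for j
    using f[OF that] that unfolding B_def by (intro eq_vecI) auto
  have "A * C = C * B"
  proof (rule eq_matI)
    fix i j assume i: "i < dim_row (C * B)" and j: "j < dim_col (C * B)"
    then have ij: "i < n" "j < r" using C B by auto
    have "(A * C) $$ (i,j) = (A *\<^sub>v col C j) $ i" using ij A C by simp
    also have "\<dots> = (C *\<^sub>v col B j) $ i" using f[OF ij(2)] colB[OF ij(2)] by simp
    also have "\<dots> = (C * B) $$ (i,j)" using ij C B by simp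
    finally show "(A * C) $$ (i,j) = (C * B) $$ (i,j)" .
  qed (use A C B in auto)
  then show ?thesis using B by blast
qed

lemma complex_mat_eigenvector:
  assumes A: "(A :: complex mat) \<in> carrier_mat n n" and n: "n > 0"
  shows "\<exists>c. \<exists>v\<in>carrier_vec n. v \<noteq> 0\<^sub>v n \<and> A *\<^sub>v v = c \<cdot>\<^sub>v v"
proof -
  have "Polynomial.degree (char_poly A) = n" using degree_monic_char_poly[OF A] by simp
  then have "\<not> constant (poly (char_poly A))" using n by (simp add: constant_degree)
  then obtain c where "poly (char_poly A) c = 0" using fundamental_theorem_of_algebra by blast
  then have "eigenvalue A c" using eigenvalue_root_char_poly[OF A] by simp
  then show ?thesis using A unfolding eigenvalue_def eigenvector_def by auto
qed

lemma invariant_subspace_eigenvector: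
  assumes W: "vec_subspace n W" and ne: "W \<noteq> {0\<^sub>v n}"
    and A: "A \<in> carrier_mat n n" and inv: "\<And>w. w \<in> W \<Longrightarrow> A *\<^sub>v w \<in> W"
  shows "\<exists>c. \<exists>w\<in>W. w \<noteq> 0\<^sub>v n \<and> A *\<^sub>v w = c \<cdot>\<^sub>v w"
proof -
  obtain r C where C: "C \<in> carrier_mat n r" and inj: "injective_mat C"
    and img: "{C *\<^sub>v v | v. v \<in> carrier_vec r} = W" using subspace_basis[OF W] .
  obtain B where B: "B \<in> carrier_mat r r" and AC: "A * C = C * B"
    using invariant_restrict[OF C img A inv] by blast
  have r: "r > 0" by (rule subspace_basis_dim_pos[OF C img ne])
  obtain c v where v: "v \<in> carrier_vec r" "v \<noteq> 0\<^sub>v r" "B *\<^sub>v v = c \<cdot>\<^sub>v v"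
    using complex_mat_eigenvector[OF B r] by blast
  have "A *\<^sub>v (C *\<^sub>v v) = C *\<^sub>v (B *\<^sub>v v)"
    using assoc_mult_mat_vec[OF A C v(1)] assoc_mult_mat_vec[OF C B v(1)] AC by simp
  also have "\<dots> = c \<cdot>\<^sub>v (C *\<^sub>v v)" using v mult_mat_vec[OF C v(1)] by simp
  finally show ?thesis using img v injective_matD[OF inj C v(1)] by blast
qed

section \<open>Traces and matrices of finite order\<close>

lemma mat_trace_mult_comm:
  fixes A B :: "complex mat"
  assumes A: "A \<in> carrier_mat n m" and B: "B \<in> carrier_mat m n"
  shows "mat_trace (A * B) = mat_trace (B * A)"
proof -
  have "mat_trace (A * B) = (\<Sum>i<n. \<Sum>j<m. A $$ (i,j) * B $$ (j,i))"
    using A B unfolding mat_trace_def by (auto simp: scalar_prod_def atLeast0LessThan intro!: sum.cong)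
  also have "\<dots> = (\<Sum>j<m. \<Sum>i<n. A $$ (i,j) * B $$ (j,i))" by (rule sum.swap)
  also have "\<dots> = mat_trace (B * A)"
    using A B unfolding mat_trace_def by (auto simp: scalar_prod_def atLeast0LessThan mult.commute intro!: sum.cong)
  finally show ?thesis .
qed

text \<open>Schur triangularisation puts the eigenvalues, with multiplicity, on the diagonal of a matrix
  similar to \<open>A\<close>.\<close>

lemma mat_trace_eigenvalues:
  assumes A: "(A :: complex mat) \<in> carrier_mat n n"
  obtains es where "mat_trace A = sum_list es" "length es = n" "\<And>c. c \<in> set es \<longleftrightarrow> eigenvalue A c"
proof -
  obtain es where es: "char_poly A = (\<Prod>a\<leftarrow>es. [:- a, 1:])" "length es = n"
    using char_poly_factorized[OF A] by blast
  obtain B P Q where "schur_decomposition A es = (B,P,Q)" by (metis prod_cases3)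
  from schur_decomposition[OF A es(1) this]
  have sim: "similar_mat_wit A B P Q" and diag: "diag_mat B = es" by auto
  note w = similar_mat_witD2[OF A sim]
  have "mat_trace A = mat_trace ((P * B) * Q)" using w by simp
  also have "\<dots> = mat_trace (Q * (P * B))"
    using w by (intro mat_trace_mult_comm[of _ n n]) auto
  also have "Q * (P * B) = (Q * P) * B" using w by (intro assoc_mult_mat[symmetric]) auto
  also have "\<dots> = B" using w by simp
  also have "mat_trace B = sum_list es"
    unfolding diag[symmetric] diag_mat_def mat_trace_def by (simp add: interv_sum_list_conv_sum_set_nat atLeast0LessThan)
  finally have "mat_trace A = sum_list es" .
  moreover have "c \<in> set es \<longleftrightarrow> eigenvalue A c" for c
    unfolding eigenvalue_root_char_poly[OF A] es(1)
    by (auto simp: poly_prod_list prod_list_zero_iff o_def)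
  ultimately show thesis using that es by blast
qed

text \<open>Each entry has real part at most \<open>1\<close>, so the real part of the sum can reach the number of
  entries only if every real part is \<open>1\<close>.\<close>

lemma unit_complex_sum_eq_length:
  fixes es :: "complex list"
  assumes "\<And>c. c \<in> set es \<Longrightarrow> norm c = 1" and "sum_list es = of_nat (length es)"
  shows "\<forall>c\<in>set es. c = 1"
proof -
  have *: "(\<forall>c\<in>set es. norm c = 1) \<Longrightarrow> Re (sum_list es) \<le> length es \<and>
    (Re (sum_list es) = length es \<longrightarrow> (\<forall>c\<in>set es. c = 1))" for es :: "complex list"
  proof (induction es)
    case (Cons a es)
    have a1: "Re a \<le> 1" using Cons.prems complex_Re_le_cmod[of a] by simp
    have "a = 1" if "Re a = 1"
    proof -
      have "(Re a)^2 + (Im a)^2 = 1" using Cons.prems by (simp add: cmod_def)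
      then show ?thesis using that by (simp add: complex_eq_iff)
    qed
    then show ?case using Cons a1 by auto
  qed simp
  show ?thesis using *[of es] assms by auto
qed

lemma vec_nonzero_entry:
  assumes "v \<in> carrier_vec n" "v \<noteq> 0\<^sub>v n"
  shows "\<exists>i<n. v $ i \<noteq> 0"
proof (rule ccontr)
  assume "\<not> ?thesis"
  then have "v = 0\<^sub>v n" using assms(1) by (intro eq_vecI) auto
  then show False using assms(2) by simp
qed

text \<open>The eigenvalues of \<open>A\<close> are roots of unity with sum \<open>n\<close>, hence all equal to \<open>1\<close>. If \<open>A\<close> were not
  the identity, the image of \<open>A - 1\<close> would be a nonzero invariant subspace and would contain an
  eigenvector \<open>w = A x - x\<close>, which \<open>A\<close> fixes. Then \<open>A\<^sup>j x = x + j w\<close> for all \<open>j\<close>, which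
  contradicts \<open>A\<^sup>k = 1\<close>.\<close>

lemma finite_order_trace_eq_dim:
  assumes A: "(A :: complex mat) \<in> carrier_mat n n" and k: "k > 0" and Ak: "A ^\<^sub>m k = 1\<^sub>m n"
    and tr: "mat_trace A = of_nat n"
  shows "A = 1\<^sub>m n"
proof -
  obtain es where es: "mat_trace A = sum_list es" "length es = n" "\<And>c. c \<in> set es \<longleftrightarrow> eigenvalue A c"
    using mat_trace_eigenvalues[OF A] by blast
  have "norm c = 1" if "eigenvalue A c" for c
  proof -
    from that obtain v where v: "eigenvector A v c" unfolding eigenvalue_def by blast
    then have vc: "v \<in> carrier_vec n" "v \<noteq> 0\<^sub>v n" using A unfolding eigenvector_def by auto
    have eq: "v = c ^ k \<cdot>\<^sub>v v" using eigenvector_pow[OF A v, of k] unfolding Ak one_mult_mat_vec[OF vc(1)] .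
    obtain i where i: "i < n" "v $ i \<noteq> 0" using vc vec_nonzero_entry by blast
    have "v $ i = (c ^ k \<cdot>\<^sub>v v) $ i" by (rule arg_cong[OF eq])
    also have "\<dots> = c ^ k * v $ i" using i vc by simp
    finally have "(c ^ k - 1) * v $ i = 0" by (simp add: algebra_simps)
    then have "c ^ k = 1" using i by simp
    then show ?thesis using k power_eq_1_iff[of c k] by auto
  qed
  then have ev1: "c = 1" if "eigenvalue A c" for c
    using unit_complex_sum_eq_length[of es] es tr that by auto
  define W where "W = {A *\<^sub>v v - v | v. v \<in> carrier_vec n}"
  have W: "vec_subspace n W"
    unfolding vec_subspace_def
  proof (intro conjI ballI allI)
    show "W \<subseteq> carrier_vec n" using A unfolding W_def by auto
    show "0\<^sub>v n \<in> W" using A unfolding W_def by (auto intro!: exI[of _ "0\<^sub>v n"])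
    fix v w assume "v \<in> W" "w \<in> W"
    then obtain x y where "v = A *\<^sub>v x - x" "w = A *\<^sub>v y - y" "x \<in> carrier_vec n" "y \<in> carrier_vec n"
      unfolding W_def by blast
    moreover from this have "v + w = A *\<^sub>v (x + y) - (x + y)"
      using A mult_add_distrib_mat_vec[OF A] by (intro eq_vecI) auto
    ultimately show "v + w \<in> W" unfolding W_def by (auto intro!: exI[of _ "x + y"])
  next
    fix c v assume "v \<in> W"
    then obtain x where "v = A *\<^sub>v x - x" "x \<in> carrier_vec n" unfolding W_def by blast
    moreover from this have "c \<cdot>\<^sub>v v = A *\<^sub>v (c \<cdot>\<^sub>v x) - (c \<cdot>\<^sub>v x)"
      using A mult_mat_vec[OF A, of x c] by (intro eq_vecI) (auto simp: algebra_simps)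
    ultimately show "c \<cdot>\<^sub>v v \<in> W" unfolding W_def by (auto intro!: exI[of _ "c \<cdot>\<^sub>v x"])
  qed
  have inv: "A *\<^sub>v w \<in> W" if w: "w \<in> W" for w
  proof -
    obtain x where x: "w = A *\<^sub>v x - x" "x \<in> carrier_vec n" using w unfolding W_def by blast
    then have "A *\<^sub>v w = A *\<^sub>v (A *\<^sub>v x) - A *\<^sub>v x"
      using A mult_minus_distrib_mat_vec[OF A] by simp
    then show ?thesis using x A unfolding W_def by (auto intro!: exI[of _ "A *\<^sub>v x"])
  qed
  have "W = {0\<^sub>v n}"
  proof (rule ccontr)
    assume "W \<noteq> {0\<^sub>v n}"
    from invariant_subspace_eigenvector[OF W this A inv]
    obtain c w where w: "w \<in> W" "w \<noteq> 0\<^sub>v n" "A *\<^sub>v w = c \<cdot>\<^sub>v w" by blast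
    obtain x where x: "w = A *\<^sub>v x - x" "x \<in> carrier_vec n" using w unfolding W_def by blast
    have wc: "w \<in> carrier_vec n" using W w(1) unfolding vec_subspace_def by blast
    have "eigenvalue A c" unfolding eigenvalue_def eigenvector_def using A w wc by auto
    then have "c = 1" by (rule ev1)
    then have Aw: "A *\<^sub>v w = w" using w wc by simp
    \<comment> \<open>Since \<open>w\<close> is fixed, each further application of \<open>A\<close> adds another copy of it.\<close>
    have "A ^\<^sub>m j *\<^sub>v x = x + (of_nat j :: complex) \<cdot>\<^sub>v w" for j
    proof (induction j)
      case 0
      show ?case using x wc A by (intro eq_vecI) auto
    next
      case (Suc j)
      have Aj: "A ^\<^sub>m j \<in> carrier_mat n n" using A by simp
      have "A ^\<^sub>m Suc j *\<^sub>v x = A ^\<^sub>m j *\<^sub>v (A *\<^sub>v x)"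
        using assoc_mult_mat_vec[OF Aj A x(2)] by simp
      also have "A *\<^sub>v x = x + w" using x A by (intro eq_vecI) auto
      also have "A ^\<^sub>m j *\<^sub>v (x + w) = A ^\<^sub>m j *\<^sub>v x + A ^\<^sub>m j *\<^sub>v w"
        using mult_add_distrib_mat_vec[OF Aj x(2) wc] .
      also have "A ^\<^sub>m j *\<^sub>v w = w"
      proof -
        have "eigenvector A w 1" unfolding eigenvector_def using A w wc Aw by auto
        then show ?thesis using eigenvector_pow[OF A, of w 1 j] by simp
      qed
      finally show ?case using Suc x wc by (intro eq_vecI) (auto simp: algebra_simps)
    qed
    from this[of k] have eq: "x = x + (of_nat k :: complex) \<cdot>\<^sub>v w"
      unfolding Ak one_mult_mat_vec[OF x(2)] .
    obtain i where i: "i < n" "w $ i \<noteq> 0" using w wc vec_nonzero_entry by blast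
    have "x $ i = (x + (of_nat k :: complex) \<cdot>\<^sub>v w) $ i" by (rule arg_cong[OF eq])
    also have "\<dots> = x $ i + of_nat k * w $ i" using i x wc by simp
    finally have "of_nat k * w $ i = 0" by simp
    then show False using i k by simp
  qed
  then have fixed: "A *\<^sub>v v = v" if "v \<in> carrier_vec n" for v
  proof -
    have "A *\<^sub>v v - v = 0\<^sub>v n" using \<open>W = {0\<^sub>v n}\<close> that unfolding W_def by blast
    then have "(A *\<^sub>v v - v) $ i = 0" if "i < n" for i using that by simp
    then show ?thesis using that A by (intro eq_vecI) auto
  qed
  show ?thesis
  proof (rule eq_matI)
    fix i j assume "i < dim_row (1\<^sub>m n :: complex mat)" "j < dim_col (1\<^sub>m n :: complex mat)"
    then have ij: "i < n" "j < n" by auto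
    have "A $$ (i,j) = (A *\<^sub>v unit_vec n j) $ i" using ij A by simp
    also have "\<dots> = unit_vec n j $ i" using fixed[of "unit_vec n j"] by simp
    finally show "A $$ (i,j) = 1\<^sub>m n $$ (i,j)" using ij by (auto simp: unit_vec_def)
  qed (use A in auto)
qed

section \<open>Finite sums of matrices\<close>

lemma mat_eqI_mult_vec:
  fixes A B :: "complex mat"
  assumes A: "A \<in> carrier_mat n m" and B: "B \<in> carrier_mat n m"
    and eq: "\<And>v. v \<in> carrier_vec m \<Longrightarrow> A *\<^sub>v v = B *\<^sub>v v"
  shows "A = B"
proof (rule eq_matI)
  fix i j assume "i < dim_row B" "j < dim_col B"
  then have ij: "i < n" "j < m" using B by auto
  have "A $$ (i,j) = (A *\<^sub>v unit_vec m j) $ i" using ij A by simp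
  also have "\<dots> = (B *\<^sub>v unit_vec m j) $ i" using eq[of "unit_vec m j"] by simp
  finally show "A $$ (i,j) = B $$ (i,j)" using ij B by simp
qed (use A B in auto)

text \<open>Matrices of all dimensions share one type, which has no zero for the empty sum; the dimensions
  are therefore passed along and the sum is taken entrywise.\<close>

definition mat_sum :: "nat \<Rightarrow> nat \<Rightarrow> 'b set \<Rightarrow> ('b \<Rightarrow> complex mat) \<Rightarrow> complex mat" where
  "mat_sum n m S F = mat n m (\<lambda>(i,j). \<Sum>x\<in>S. F x $$ (i,j))"

lemma mat_sum_carrier [simp]: "mat_sum n m S F \<in> carrier_mat n m"
  and mat_sum_index: "i < n \<Longrightarrow> j < m \<Longrightarrow> mat_sum n m S F $$ (i,j) = (\<Sum>x\<in>S. F x $$ (i,j))"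
  unfolding mat_sum_def by auto

lemma mat_sum_dims [simp]: "dim_row (mat_sum n m S F) = n" "dim_col (mat_sum n m S F) = m"
  unfolding mat_sum_def by auto

lemma mat_sum_cong: "(\<And>x. x \<in> S \<Longrightarrow> F x = H x) \<Longrightarrow> mat_sum n m S F = mat_sum n m S H"
  unfolding mat_sum_def by (intro eq_matI) auto

lemma mult_mat_sum:
  assumes A: "A \<in> carrier_mat k n" and F: "\<And>x. x \<in> S \<Longrightarrow> F x \<in> carrier_mat n m"
  shows "A * mat_sum n m S F = mat_sum k m S (\<lambda>x. A * F x)"
proof (rule eq_matI)
  fix i j assume "i < dim_row (mat_sum k m S (\<lambda>x. A * F x))" "j < dim_col (mat_sum k m S (\<lambda>x. A * F x))"
  then have ij: "i < k" "j < m" by auto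
  have "(A * mat_sum n m S F) $$ (i,j) = (\<Sum>l<n. \<Sum>x\<in>S. A $$ (i,l) * F x $$ (l,j))"
    using A ij by (auto simp: scalar_prod_def mat_sum_index atLeast0LessThan sum_distrib_left intro!: sum.cong)
  also have "\<dots> = (\<Sum>x\<in>S. \<Sum>l<n. A $$ (i,l) * F x $$ (l,j))" by (rule sum.swap)
  also have "\<dots> = (\<Sum>x\<in>S. (A * F x) $$ (i,j))"
  proof (rule sum.cong[OF refl])
    fix x assume "x \<in> S"
    then have "F x \<in> carrier_mat n m" by (rule F)
    then show "(\<Sum>l<n. A $$ (i,l) * F x $$ (l,j)) = (A * F x) $$ (i,j)"
      using A ij by (auto simp: scalar_prod_def atLeast0LessThan)
  qed
  finally show "(A * mat_sum n m S F) $$ (i,j) = mat_sum k m S (\<lambda>x. A * F x) $$ (i,j)"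
    using ij by (simp add: mat_sum_index)
qed (use A in auto)

lemma mat_sum_mult:
  assumes B: "B \<in> carrier_mat m k" and F: "\<And>x. x \<in> S \<Longrightarrow> F x \<in> carrier_mat n m"
  shows "mat_sum n m S F * B = mat_sum n k S (\<lambda>x. F x * B)"
proof (rule eq_matI)
  fix i j assume "i < dim_row (mat_sum n k S (\<lambda>x. F x * B))" "j < dim_col (mat_sum n k S (\<lambda>x. F x * B))"
  then have ij: "i < n" "j < k" by auto
  have "(mat_sum n m S F * B) $$ (i,j) = (\<Sum>l<m. \<Sum>x\<in>S. F x $$ (i,l) * B $$ (l,j))"
    using B ij by (auto simp: scalar_prod_def mat_sum_index atLeast0LessThan sum_distrib_right intro!: sum.cong)
  also have "\<dots> = (\<Sum>x\<in>S. \<Sum>l<m. F x $$ (i,l) * B $$ (l,j))" by (rule sum.swap)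
  also have "\<dots> = (\<Sum>x\<in>S. (F x * B) $$ (i,j))"
  proof (rule sum.cong[OF refl])
    fix x assume "x \<in> S"
    then have "F x \<in> carrier_mat n m" by (rule F)
    then show "(\<Sum>l<m. F x $$ (i,l) * B $$ (l,j)) = (F x * B) $$ (i,j)"
      using B ij by (auto simp: scalar_prod_def atLeast0LessThan)
  qed
  finally show "(mat_sum n m S F * B) $$ (i,j) = mat_sum n k S (\<lambda>x. F x * B) $$ (i,j)"
    using ij by (simp add: mat_sum_index)
qed (use B in auto)

lemma mat_sum_reindex:
  assumes "bij_betw h S T"
  shows "mat_sum n m T F = mat_sum n m S (\<lambda>x. F (h x))"
  unfolding mat_sum_def by (intro eq_matI) (auto simp: sum.reindex_bij_betw[OF assms, symmetric])

lemma mat_trace_mat_sum: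
  assumes "\<And>x. x \<in> S \<Longrightarrow> F x \<in> carrier_mat n n"
  shows "mat_trace (mat_sum n n S F) = (\<Sum>x\<in>S. mat_trace (F x))"
proof -
  have "mat_trace (mat_sum n n S F) = (\<Sum>i<n. \<Sum>x\<in>S. F x $$ (i,i))"
    unfolding mat_trace_def by (auto simp: mat_sum_index)
  also have "\<dots> = (\<Sum>x\<in>S. \<Sum>i<n. F x $$ (i,i))" by (rule sum.swap)
  also have "\<dots> = (\<Sum>x\<in>S. mat_trace (F x))"
    using assms unfolding mat_trace_def by (intro sum.cong) auto
  finally show ?thesis .
qed

lemma mat_trace_smult:
  "A \<in> carrier_mat n n \<Longrightarrow> mat_trace (c \<cdot>\<^sub>m A) = (c :: complex) * mat_trace A"
  unfolding mat_trace_def by (auto simp: sum_distrib_left)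

lemma mat_trace_one [simp]: "mat_trace (1\<^sub>m n :: complex mat) = of_nat n"
  unfolding mat_trace_def by simp

definition elem_mat :: "nat \<Rightarrow> nat \<Rightarrow> nat \<Rightarrow> nat \<Rightarrow> complex mat" where
  "elem_mat n m a b = mat n m (\<lambda>(i,j). if i = a \<and> j = b then 1 else 0)"

lemma elem_mat_carrier [simp]: "elem_mat n m a b \<in> carrier_mat n m"
  unfolding elem_mat_def by simp

lemma elem_mat_sandwich:
  assumes A: "A \<in> carrier_mat n n" and B: "B \<in> carrier_mat m m"
    and ab: "a < n" "b < m" and ij: "i < n" "j < m"
  shows "(A * elem_mat n m a b * B) $$ (i,j) = A $$ (i,a) * B $$ (b,j)"
proof -
  have AE: "(A * elem_mat n m a b) $$ (i,l) = (if l = b then A $$ (i,a) else 0)" if l: "l < m" for l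
  proof -
    have "(A * elem_mat n m a b) $$ (i,l) = (\<Sum>k<n. A $$ (i,k) * (if k = a \<and> l = b then 1 else 0))"
      using A ij l unfolding elem_mat_def by (auto simp: scalar_prod_def atLeast0LessThan)
    also have "\<dots> = (\<Sum>k<n. if k = a then (if l = b then A $$ (i,a) else 0) else 0)"
      by (intro sum.cong) auto
    also have "\<dots> = (if l = b then A $$ (i,a) else 0)" using ab by simp
    finally show ?thesis .
  qed
  have "(A * elem_mat n m a b * B) $$ (i,j) = (\<Sum>l<m. (A * elem_mat n m a b) $$ (i,l) * B $$ (l,j))"
    using A B ij by (auto simp: scalar_prod_def atLeast0LessThan elem_mat_def)
  also have "\<dots> = (\<Sum>l<m. if l = b then A $$ (i,a) * B $$ (b,j) else 0)"
    by (intro sum.cong) (auto simp: AE)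
  also have "\<dots> = A $$ (i,a) * B $$ (b,j)" using ab by simp
  finally show ?thesis .
qed

lemma injective_mat_mult:
  assumes C: "C \<in> carrier_mat n r" "injective_mat C" and D: "D \<in> carrier_mat r s" "injective_mat D"
  shows "injective_mat (C * D)"
  unfolding injective_mat_def
proof (intro ballI impI)
  fix v assume "v \<in> carrier_vec (dim_col (C * D))" and z: "(C * D) *\<^sub>v v = 0\<^sub>v (dim_row (C * D))"
  then have v: "v \<in> carrier_vec s" using D by simp
  have "C *\<^sub>v (D *\<^sub>v v) = 0\<^sub>v n" using z assoc_mult_mat_vec[OF C(1) D(1) v] C by simp
  then have "D *\<^sub>v v = 0\<^sub>v r" using D v by (intro injective_matD[OF C(2) C(1)]) auto
  then show "v = 0\<^sub>v (dim_col (C * D))" using injective_matD[OF D(2,1) v] D by simp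
qed

section \<open>Representations and Schur's lemma\<close>

text \<open>Here \<open>T\<close> is a homomorphism from the space of \<open>\<sigma>\<close> to the space of \<open>\<rho>\<close>.\<close>

definition intertwines ::
    "('a, 'b) monoid_scheme \<Rightarrow> ('a \<Rightarrow> complex mat) \<Rightarrow> complex mat \<Rightarrow> ('a \<Rightarrow> complex mat) \<Rightarrow> bool" where
  "intertwines G \<rho> T \<sigma> \<longleftrightarrow> (\<forall>g\<in>carrier G. \<rho> g * T = T * \<sigma> g)"

definition invariant_subspace ::
    "('a, 'b) monoid_scheme \<Rightarrow> nat \<Rightarrow> ('a \<Rightarrow> complex mat) \<Rightarrow> complex vec set \<Rightarrow> bool" where
  "invariant_subspace G n \<rho> W \<longleftrightarrow> vec_subspace n W \<and> (\<forall>g\<in>carrier G. \<forall>w\<in>W. \<rho> g *\<^sub>v w \<in> W)"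

lemma vec_subspace_eigenspace:
  assumes A: "(A :: complex mat) \<in> carrier_mat n n"
  shows "vec_subspace n {v \<in> carrier_vec n. A *\<^sub>v v = c \<cdot>\<^sub>v v}"
  unfolding vec_subspace_def using A
  by (auto simp: mult_add_distrib_mat_vec[OF A] mult_mat_vec[OF A] smult_add_distrib_vec smult_smult_assoc mult.commute)

lemma vec_subspace_kernel:
  assumes A: "(A :: complex mat) \<in> carrier_mat n m"
  shows "vec_subspace m {v \<in> carrier_vec m. A *\<^sub>v v = 0\<^sub>v n}"
  unfolding vec_subspace_def using A
  by (auto simp: mult_add_distrib_mat_vec[OF A] mult_mat_vec[OF A])

lemma vec_subspace_image:
  assumes A: "(A :: complex mat) \<in> carrier_mat n m" and W: "vec_subspace m W"
  shows "vec_subspace n {A *\<^sub>v v | v. v \<in> W}"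
  unfolding vec_subspace_def
proof (intro conjI ballI allI)
  have Wc: "W \<subseteq> carrier_vec m" using W unfolding vec_subspace_def by blast
  show "{A *\<^sub>v v | v. v \<in> W} \<subseteq> carrier_vec n" using A Wc by (auto intro: mult_mat_vec_carrier)
  show "0\<^sub>v n \<in> {A *\<^sub>v v | v. v \<in> W}" using A W unfolding vec_subspace_def by (auto intro!: exI[of _ "0\<^sub>v m"])
  fix v w assume "v \<in> {A *\<^sub>v v | v. v \<in> W}" "w \<in> {A *\<^sub>v v | v. v \<in> W}"
  then obtain x y where xy: "v = A *\<^sub>v x" "w = A *\<^sub>v y" "x \<in> W" "y \<in> W" by blast
  then have "x \<in> carrier_vec m" "y \<in> carrier_vec m" using Wc by auto
  with xy show "v + w \<in> {A *\<^sub>v v | v. v \<in> W}" using W Wc mult_add_distrib_mat_vec[OF A, of x y]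
    unfolding vec_subspace_def by (auto intro!: exI[of _ "x + y"])
next
  have Wc: "W \<subseteq> carrier_vec m" using W unfolding vec_subspace_def by blast
  fix c v assume "v \<in> {A *\<^sub>v v | v. v \<in> W}"
  then obtain x where x: "v = A *\<^sub>v x" "x \<in> W" by blast
  then have "x \<in> carrier_vec m" using Wc by auto
  with x show "c \<cdot>\<^sub>v v \<in> {A *\<^sub>v v | v. v \<in> W}" using W Wc mult_mat_vec[OF A, of x c]
    unfolding vec_subspace_def by (auto intro!: exI[of _ "c \<cdot>\<^sub>v x"])
qed

lemma vec_subspace_carrier: "vec_subspace n (carrier_vec n)"
  unfolding vec_subspace_def by auto

locale finite_group = group G for G (structure) +
  assumes fin: "finite (carrier G)"
begin

lemma representation_iff:
  "representation G n \<rho> \<longleftrightarrow> (\<forall>g\<in>carrier G. \<rho> g \<in> carrier_mat n n) \<and>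
     (\<forall>g\<in>carrier G. \<forall>h\<in>carrier G. \<rho> (g \<otimes> h) = \<rho> g * \<rho> h) \<and> \<rho> \<one> = 1\<^sub>m n"
  (is "?l \<longleftrightarrow> ?r")
proof
  let ?R = "ring_mat TYPE(complex) n ()"
  interpret R: ring ?R by (rule ring_mat)
  assume ?l
  then have h: "\<rho> \<in> hom G (units_of ?R)" unfolding representation_def .
  then interpret group_hom G "units_of ?R" \<rho>
    by (intro group_hom.intro group_hom_axioms.intro is_group R.units_group)
  have "\<rho> \<one> = 1\<^sub>m n" using hom_one by (simp add: units_of_def ring_mat_simps)
  moreover have "\<rho> g \<in> carrier_mat n n" if "g \<in> carrier G" for g
    using hom_closed[OF that] by (simp add: units_of_def Units_def ring_mat_simps)
  moreover have "\<rho> (g \<otimes> k) = \<rho> g * \<rho> k" if "g \<in> carrier G" "k \<in> carrier G" for g k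
    using hom_mult[OF that] by (simp add: units_of_def ring_mat_simps)
  ultimately show ?r by blast
next
  assume r: ?r
  have "\<rho> g * \<rho> (inv g) = 1\<^sub>m n" "\<rho> (inv g) * \<rho> g = 1\<^sub>m n" if "g \<in> carrier G" for g
    using r that by (metis inv_closed r_inv l_inv)+
  then have "\<exists>B\<in>carrier_mat n n. B * \<rho> g = 1\<^sub>m n \<and> \<rho> g * B = 1\<^sub>m n" if "g \<in> carrier G" for g
    using r that by (intro bexI[of _ "\<rho> (inv g)"]) auto
  then show ?l unfolding representation_def hom_def units_of_def Units_def
    using r by (auto simp: ring_mat_simps)
qed

lemma irreducible_iff:
  "irreducible_representation G n \<rho> \<longleftrightarrow> representation G n \<rho> \<and> n > 0 \<and>
     (\<forall>W. invariant_subspace G n \<rho> W \<longrightarrow> W = {0\<^sub>v n} \<or> W = carrier_vec n)"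
  unfolding irreducible_representation_def subspace_iff_lin_sub invariant_subspace_def by blast

lemma repD:
  assumes "representation G n \<rho>"
  shows "g \<in> carrier G \<Longrightarrow> \<rho> g \<in> carrier_mat n n"
    and "g \<in> carrier G \<Longrightarrow> h \<in> carrier G \<Longrightarrow> \<rho> (g \<otimes> h) = \<rho> g * \<rho> h"
    and "\<rho> \<one> = 1\<^sub>m n"
  using assms unfolding representation_iff by auto

lemma rep_inv:
  assumes "representation G n \<rho>" "g \<in> carrier G"
  shows "\<rho> g * \<rho> (inv g) = 1\<^sub>m n" "\<rho> (inv g) * \<rho> g = 1\<^sub>m n"
  using repD[OF assms(1)] assms(2) by (metis inv_closed r_inv l_inv)+

lemma irreducible_rep: "irreducible_representation G n \<rho> \<Longrightarrow> representation G n \<rho>"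
  unfolding irreducible_iff by simp

lemma invariant_subspace_dichotomy:
  "irreducible_representation G n \<rho> \<Longrightarrow> invariant_subspace G n \<rho> W \<Longrightarrow> W = {0\<^sub>v n} \<or> W = carrier_vec n"
  unfolding irreducible_iff by simp

lemma commuting_eigenspace_invariant:
  assumes \<rho>: "representation G n \<rho>" and A: "A \<in> carrier_mat n n" and AC: "intertwines G \<rho> A \<rho>"
  shows "invariant_subspace G n \<rho> {v \<in> carrier_vec n. A *\<^sub>v v = c \<cdot>\<^sub>v v}"
  unfolding invariant_subspace_def
proof (intro conjI ballI)
  fix g w assume g: "g \<in> carrier G" and "w \<in> {v \<in> carrier_vec n. A *\<^sub>v v = c \<cdot>\<^sub>v v}"
  then have w: "w \<in> carrier_vec n" "A *\<^sub>v w = c \<cdot>\<^sub>v w" by auto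
  note \<rho>g = repD(1)[OF \<rho> g]
  have "A *\<^sub>v (\<rho> g *\<^sub>v w) = \<rho> g *\<^sub>v (A *\<^sub>v w)"
    using AC g assoc_mult_mat_vec[OF A \<rho>g w(1)] assoc_mult_mat_vec[OF \<rho>g A w(1)]
    unfolding intertwines_def by simp
  then have "A *\<^sub>v (\<rho> g *\<^sub>v w) = c \<cdot>\<^sub>v (\<rho> g *\<^sub>v w)" using w mult_mat_vec[OF \<rho>g w(1)] by simp
  then show "\<rho> g *\<^sub>v w \<in> {v \<in> carrier_vec n. A *\<^sub>v v = c \<cdot>\<^sub>v v}" using \<rho>g w by simp
qed (rule vec_subspace_eigenspace[OF A])

text \<open>Schur's lemma: the eigenspace of \<open>A\<close> for any of its eigenvalues is a nonzero invariant
  subspace, hence the whole space.\<close>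

lemma schur_scalar:
  assumes \<rho>: "irreducible_representation G n \<rho>" and A: "A \<in> carrier_mat n n"
    and AC: "intertwines G \<rho> A \<rho>"
  shows "\<exists>c. A = c \<cdot>\<^sub>m 1\<^sub>m n"
proof -
  have n: "n > 0" using \<rho> unfolding irreducible_iff by simp
  obtain c v where v: "v \<in> carrier_vec n" "v \<noteq> 0\<^sub>v n" "A *\<^sub>v v = c \<cdot>\<^sub>v v"
    using complex_mat_eigenvector[OF A n] by blast
  let ?W = "{v \<in> carrier_vec n. A *\<^sub>v v = c \<cdot>\<^sub>v v}"
  have "?W = {0\<^sub>v n} \<or> ?W = carrier_vec n"
    using invariant_subspace_dichotomy[OF \<rho> commuting_eigenspace_invariant[OF irreducible_rep[OF \<rho>] A AC]] .
  moreover have "v \<in> ?W" using v by simp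
  ultimately have W: "?W = carrier_vec n" using v(2) by blast
  have "A = c \<cdot>\<^sub>m 1\<^sub>m n"
  proof (rule mat_eqI_mult_vec[OF A])
    fix w :: "complex vec" assume w: "w \<in> carrier_vec n"
    then have "A *\<^sub>v w = c \<cdot>\<^sub>v w" using W by blast
    also have "\<dots> = (c \<cdot>\<^sub>m 1\<^sub>m n) *\<^sub>v w"
      using w by (intro eq_vecI) (auto simp: scalar_prod_def if_distrib if_distribR sum.delta cong: if_cong)
    finally show "A *\<^sub>v w = (c \<cdot>\<^sub>m 1\<^sub>m n) *\<^sub>v w" .
  qed simp
  then show ?thesis by blast
qed

text \<open>The kernel and the image of \<open>T\<close> are invariant, so \<open>T\<close> is bijective. Its inverse \<open>R\<close> conjugates
  one representation into the other, and conjugation preserves traces.\<close>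

lemma schur_equal_characters:
  assumes \<rho>: "irreducible_representation G n \<rho>" and \<sigma>: "irreducible_representation G m \<sigma>"
    and T: "T \<in> carrier_mat n m" and TC: "intertwines G \<rho> T \<sigma>" and T0: "T \<noteq> 0\<^sub>m n m"
  shows "rep_character G \<rho> = rep_character G \<sigma>"
proof -
  note \<rho>c = repD(1)[OF irreducible_rep[OF \<rho>]] and \<sigma>c = repD(1)[OF irreducible_rep[OF \<sigma>]]
  have comm: "\<rho> g *\<^sub>v (T *\<^sub>v v) = T *\<^sub>v (\<sigma> g *\<^sub>v v)" if "g \<in> carrier G" "v \<in> carrier_vec m" for g v
    using assoc_mult_mat_vec[OF \<rho>c[OF that(1)] T that(2)] assoc_mult_mat_vec[OF T \<sigma>c[OF that(1)] that(2)]
      TC that unfolding intertwines_def by simp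
  obtain v0 where v0: "v0 \<in> carrier_vec m" "T *\<^sub>v v0 \<noteq> 0\<^sub>v n"
  proof -
    have "\<exists>v\<in>carrier_vec m. T *\<^sub>v v \<noteq> 0\<^sub>m n m *\<^sub>v v"
      using mat_eqI_mult_vec[OF T, of "0\<^sub>m n m"] T0 by auto
    moreover have "0\<^sub>m n m *\<^sub>v v = 0\<^sub>v n" if "v \<in> carrier_vec m" for v :: "complex vec"
      using that by (intro eq_vecI) (auto simp: scalar_prod_def)
    ultimately show ?thesis using that by auto
  qed
  let ?K = "{v \<in> carrier_vec m. T *\<^sub>v v = 0\<^sub>v n}"
  have "invariant_subspace G m \<sigma> ?K"
    unfolding invariant_subspace_def
  proof (intro conjI ballI)
    fix g w assume g: "g \<in> carrier G" and w: "w \<in> ?K"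
    have "\<rho> g *\<^sub>v 0\<^sub>v n = 0\<^sub>v n" using \<rho>c[OF g] by auto
    then show "\<sigma> g *\<^sub>v w \<in> ?K" using w comm[OF g, of w] \<sigma>c[OF g] by auto
  qed (rule vec_subspace_kernel[OF T])
  then have K: "?K = {0\<^sub>v m}" using invariant_subspace_dichotomy[OF \<sigma>] v0 by blast
  have inj: "injective_mat T" using K T unfolding injective_mat_def by auto
  let ?I = "{T *\<^sub>v v | v. v \<in> carrier_vec m}"
  have "invariant_subspace G n \<rho> ?I"
    unfolding invariant_subspace_def
  proof (intro conjI ballI)
    fix g w assume g: "g \<in> carrier G" and "w \<in> ?I"
    then obtain v where v: "w = T *\<^sub>v v" "v \<in> carrier_vec m" by blast
    have "\<rho> g *\<^sub>v w = T *\<^sub>v (\<sigma> g *\<^sub>v v)" using comm[OF g v(2)] v by simp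
    moreover have "\<sigma> g *\<^sub>v v \<in> carrier_vec m" using \<sigma>c[OF g] v by auto
    ultimately show "\<rho> g *\<^sub>v w \<in> ?I" by blast
  qed (rule vec_subspace_image[OF T vec_subspace_carrier])
  then have I: "?I = carrier_vec n" using invariant_subspace_dichotomy[OF \<rho>] v0 by blast
  have "\<exists>v\<in>carrier_vec m. T *\<^sub>v v = unit_vec n j" for j
  proof -
    have "unit_vec n j \<in> ?I" unfolding I by simp
    then show ?thesis by force
  qed
  then obtain f where f: "\<And>j. f j \<in> carrier_vec m" "\<And>j. T *\<^sub>v f j = unit_vec n j" by metis
  \<comment> \<open>The columns of the right inverse are preimages of the unit vectors.\<close>
  define R where "R = mat m n (\<lambda>(i,j). f j $ i)"
  have R: "R \<in> carrier_mat m n" unfolding R_def by simp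
  have colR: "col R j = f j" if "j < n" for j
    using f(1)[of j] that unfolding R_def by (intro eq_vecI) auto
  have TR: "T * R = 1\<^sub>m n"
  proof (rule eq_matI)
    fix i j assume "i < dim_row (1\<^sub>m n :: complex mat)" "j < dim_col (1\<^sub>m n :: complex mat)"
    then have ij: "i < n" "j < n" by auto
    have "(T * R) $$ (i,j) = (T *\<^sub>v col R j) $ i" using ij T R by simp
    also have "\<dots> = unit_vec n j $ i" using colR[OF ij(2)] f by simp
    finally show "(T * R) $$ (i,j) = 1\<^sub>m n $$ (i,j)" using ij by (auto simp: unit_vec_def)
  qed (use T R in auto)
  have RT: "R * T = 1\<^sub>m m"
  proof (rule mat_eqI_mult_vec[of _ m m])
    fix v :: "complex vec" assume v: "v \<in> carrier_vec m"
    have Tv: "T *\<^sub>v v \<in> carrier_vec n" using T v by auto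
    have RTv: "R *\<^sub>v (T *\<^sub>v v) \<in> carrier_vec m" using mult_mat_vec_carrier[OF R Tv] .
    have "T *\<^sub>v (R *\<^sub>v (T *\<^sub>v v) - v) = T *\<^sub>v (R *\<^sub>v (T *\<^sub>v v)) - T *\<^sub>v v"
      using mult_minus_distrib_mat_vec[OF T RTv v] .
    also have "T *\<^sub>v (R *\<^sub>v (T *\<^sub>v v)) = T *\<^sub>v v"
      using assoc_mult_mat_vec[OF T R Tv] TR Tv by simp
    finally have "T *\<^sub>v (R *\<^sub>v (T *\<^sub>v v) - v) = 0\<^sub>v n" using Tv by simp
    then have z: "R *\<^sub>v (T *\<^sub>v v) - v = 0\<^sub>v m"
      using injective_matD[OF inj T] RTv v by simp
    have "R *\<^sub>v (T *\<^sub>v v) = v"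
    proof (rule eq_vecI)
      fix i assume i: "i < dim_vec v"
      have "(R *\<^sub>v (T *\<^sub>v v) - v) $ i = 0" using z i v by simp
      then show "(R *\<^sub>v (T *\<^sub>v v)) $ i = v $ i" using i by simp
    qed (use R v in simp)
    then show "(R * T) *\<^sub>v v = 1\<^sub>m m *\<^sub>v v" using assoc_mult_mat_vec[OF R T v] v by simp
  qed (use R T in auto)
  have "mat_trace (\<rho> g) = mat_trace (\<sigma> g)" if g: "g \<in> carrier G" for g
  proof -
    have "mat_trace (\<sigma> g) = mat_trace ((R * T) * \<sigma> g)" using RT \<sigma>c[OF g] by simp
    also have "(R * T) * \<sigma> g = R * (T * \<sigma> g)" using R T \<sigma>c[OF g] by (intro assoc_mult_mat) auto
    also have "T * \<sigma> g = \<rho> g * T" using TC g unfolding intertwines_def by simp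
    also have "mat_trace (R * (\<rho> g * T)) = mat_trace ((\<rho> g * T) * R)"
      using R T \<rho>c[OF g] by (intro mat_trace_mult_comm[of _ m n]) auto
    also have "(\<rho> g * T) * R = \<rho> g * (T * R)" using R T \<rho>c[OF g] by (intro assoc_mult_mat) auto
    also have "\<dots> = \<rho> g" using TR \<rho>c[OF g] by simp
    finally show ?thesis by simp
  qed
  then show ?thesis unfolding rep_character_def by (intro restrict_ext) simp
qed

section \<open>Orthogonality of irreducible characters\<close>

lemma bij_betw_left_mult:
  assumes "g \<in> carrier G"
  shows "bij_betw (\<lambda>x. g \<otimes> x) (carrier G) (carrier G)"
  using assms by (intro bij_betw_byWitness[where f' = "\<lambda>x. inv g \<otimes> x"]) (auto simp: m_assoc[symmetric])

lemma bij_betw_inv: "bij_betw (\<lambda>x. inv x) (carrier G) (carrier G)"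
  by (intro bij_betw_byWitness[where f' = "\<lambda>x. inv x"]) auto

text \<open>Averaging over the group turns an arbitrary matrix into an intertwiner. For an elementary matrix
  \<open>T\<close> the entries of the average are the sums of products of matrix coefficients that
  occur in the orthogonality relations.\<close>

definition averaged where
  "averaged n m \<rho> \<sigma> T = mat_sum n m (carrier G) (\<lambda>x. \<rho> x * T * \<sigma> (inv x))"

lemma averaged_intertwines:
  assumes \<rho>: "representation G n \<rho>" and \<sigma>: "representation G m \<sigma>" and T: "T \<in> carrier_mat n m"
  shows "intertwines G \<rho> (averaged n m \<rho> \<sigma> T) \<sigma>"
  unfolding intertwines_def
proof
  fix g assume g: "g \<in> carrier G"
  note \<rho>c = repD(1)[OF \<rho>] and \<sigma>c = repD(1)[OF \<sigma>]
  have c: "\<rho> x * T * \<sigma> (inv x) \<in> carrier_mat n m" if "x \<in> carrier G" for x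
    using \<rho>c[OF that] \<sigma>c[of "inv x"] T that by auto
  have "\<rho> g * averaged n m \<rho> \<sigma> T = mat_sum n m (carrier G) (\<lambda>x. \<rho> g * (\<rho> x * T * \<sigma> (inv x)))"
    unfolding averaged_def by (rule mult_mat_sum[OF \<rho>c[OF g] c])
  also have "\<dots> = mat_sum n m (carrier G) (\<lambda>x. (\<rho> (g \<otimes> x) * T * \<sigma> (inv (g \<otimes> x))) * \<sigma> g)"
  proof (rule mat_sum_cong)
    fix x assume x: "x \<in> carrier G"
    have s: "\<sigma> (inv x) = \<sigma> (inv (g \<otimes> x)) * \<sigma> g"
      using x g repD(2)[OF \<sigma>, of "inv (g \<otimes> x)" g] by (simp add: inv_mult_group m_assoc)
    have xs: "\<rho> x \<in> carrier_mat n n" "\<sigma> (inv (g \<otimes> x)) \<in> carrier_mat m m" "\<sigma> g \<in> carrier_mat m m" "\<rho> g \<in> carrier_mat n n"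
      using \<rho>c[OF x] \<sigma>c[of "inv (g \<otimes> x)"] \<sigma>c[OF g] \<rho>c[OF g] x g by auto
    have "\<rho> g * (\<rho> x * T * \<sigma> (inv x)) = \<rho> g * (\<rho> x * T * (\<sigma> (inv (g \<otimes> x)) * \<sigma> g))" by (simp only: s)
    also have "\<dots> = \<rho> g * \<rho> x * T * \<sigma> (inv (g \<otimes> x)) * \<sigma> g"
      using xs T by (simp add: assoc_mult_mat[where ?n\<^sub>1.0 = n] mult_carrier_mat[of _ n _ _ m] mult_carrier_mat[of _ m _ _ m]
          assoc_mult_mat[of _ n n _ m _ m] assoc_mult_mat[of _ n n _ n _ m] assoc_mult_mat[of _ n m _ m _ m])
    also have "\<rho> g * \<rho> x = \<rho> (g \<otimes> x)" using repD(2)[OF \<rho> g x] by simp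
    finally show "\<rho> g * (\<rho> x * T * \<sigma> (inv x)) = \<rho> (g \<otimes> x) * T * \<sigma> (inv (g \<otimes> x)) * \<sigma> g" .
  qed
  also have "\<dots> = mat_sum n m (carrier G) (\<lambda>x. (\<rho> x * T * \<sigma> (inv x)) * \<sigma> g)"
    by (rule mat_sum_reindex[OF bij_betw_left_mult[OF g], symmetric])
  also have "\<dots> = averaged n m \<rho> \<sigma> T * \<sigma> g"
    unfolding averaged_def by (rule mat_sum_mult[OF \<sigma>c[OF g] c, symmetric])
  finally show "\<rho> g * averaged n m \<rho> \<sigma> T = averaged n m \<rho> \<sigma> T * \<sigma> g" .
qed

lemma averaged_elem_mat_index:
  assumes \<rho>: "representation G n \<rho>" and \<sigma>: "representation G m \<sigma>"
    and ab: "a < n" "b < m" and ij: "i < n" "j < m"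
  shows "averaged n m \<rho> \<sigma> (elem_mat n m a b) $$ (i,j) = (\<Sum>x\<in>carrier G. \<rho> x $$ (i,a) * \<sigma> (inv x) $$ (b,j))"
  unfolding averaged_def mat_sum_index[OF ij]
  using elem_mat_sandwich[OF repD(1)[OF \<rho>] repD(1)[OF \<sigma>] ab ij] by (intro sum.cong) auto

lemma character_product_sum:
  assumes \<rho>: "representation G n \<rho>" and \<sigma>: "representation G m \<sigma>"
  shows "(\<Sum>x\<in>carrier G. rep_character G \<rho> x * rep_character G \<sigma> (inv x)) =
    (\<Sum>a<n. \<Sum>b<m. averaged n m \<rho> \<sigma> (elem_mat n m a b) $$ (a,b))"
proof -
  have "(\<Sum>x\<in>carrier G. rep_character G \<rho> x * rep_character G \<sigma> (inv x)) =
    (\<Sum>x\<in>carrier G. \<Sum>a<n. \<Sum>b<m. \<rho> x $$ (a,a) * \<sigma> (inv x) $$ (b,b))"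
  proof (rule sum.cong[OF refl])
    fix x assume x: "x \<in> carrier G"
    have "rep_character G \<rho> x = (\<Sum>a<n. \<rho> x $$ (a,a))" "rep_character G \<sigma> (inv x) = (\<Sum>b<m. \<sigma> (inv x) $$ (b,b))"
      using x repD(1)[OF \<rho> x] repD(1)[OF \<sigma>, of "inv x"] unfolding rep_character_def mat_trace_def by auto
    then show "rep_character G \<rho> x * rep_character G \<sigma> (inv x) = (\<Sum>a<n. \<Sum>b<m. \<rho> x $$ (a,a) * \<sigma> (inv x) $$ (b,b))"
      by (simp add: sum_product)
  qed
  also have "\<dots> = (\<Sum>a<n. \<Sum>x\<in>carrier G. \<Sum>b<m. \<rho> x $$ (a,a) * \<sigma> (inv x) $$ (b,b))" by (rule sum.swap)
  also have "\<dots> = (\<Sum>a<n. \<Sum>b<m. \<Sum>x\<in>carrier G. \<rho> x $$ (a,a) * \<sigma> (inv x) $$ (b,b))"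
    by (intro sum.cong refl sum.swap)
  also have "\<dots> = (\<Sum>a<n. \<Sum>b<m. averaged n m \<rho> \<sigma> (elem_mat n m a b) $$ (a,b))"
    by (intro sum.cong refl averaged_elem_mat_index[OF \<rho> \<sigma>, symmetric]) auto
  finally show ?thesis .
qed

text \<open>For different characters Schur's lemma makes all averages vanish. For a single representation of
  degree \<open>n\<close>, the average of the elementary matrix at \<open>(a,b)\<close> is a scalar matrix with the trace
  \<open>|G|\<close> or \<open>0\<close>, according to whether \<open>a = b\<close>, so each of the \<open>n\<close> pairs
  with \<open>a = b\<close> contributes \<open>|G| / n\<close>.
  Writing \<open>\<theta>(x\<^sup>-\<^sup>1)\<close> instead of the complex conjugate of \<open>\<theta>(x)\<close> keeps the relation purely algebraic.\<close>

theorem row_orthogonality: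
  assumes \<chi>: "\<chi> \<in> Irr G" and \<theta>: "\<theta> \<in> Irr G"
  shows "(\<Sum>x\<in>carrier G. \<chi> x * \<theta> (inv x)) = (if \<chi> = \<theta> then of_nat (card (carrier G)) else 0)"
proof (cases "\<chi> = \<theta>")
  case False
  obtain n \<rho> where \<rho>: "irreducible_representation G n \<rho>" "\<chi> = rep_character G \<rho>" using \<chi> unfolding Irr_def by blast
  obtain m \<sigma> where \<sigma>: "irreducible_representation G m \<sigma>" "\<theta> = rep_character G \<sigma>" using \<theta> unfolding Irr_def by blast
  note r = irreducible_rep[OF \<rho>(1)] irreducible_rep[OF \<sigma>(1)]
  have "averaged n m \<rho> \<sigma> (elem_mat n m a b) = 0\<^sub>m n m" for a b
    using schur_equal_characters[OF \<rho>(1) \<sigma>(1) _ averaged_intertwines[OF r elem_mat_carrier, of a b]] False \<rho>(2) \<sigma>(2)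
    by (auto simp: averaged_def)
  then show ?thesis using False character_product_sum[OF r] \<rho> \<sigma> by simp
next
  case True
  obtain n \<rho> where \<rho>: "irreducible_representation G n \<rho>" "\<chi> = rep_character G \<rho>" using \<chi> unfolding Irr_def by blast
  note r = irreducible_rep[OF \<rho>(1)]
  have n: "n > 0" using \<rho>(1) unfolding irreducible_iff by simp
  have e: "averaged n n \<rho> \<rho> (elem_mat n n a b) $$ (a,b) = (if a = b then of_nat (card (carrier G)) / of_nat n else 0)"
    if ab: "a < n" "b < n" for a b
  proof -
    let ?A = "averaged n n \<rho> \<rho> (elem_mat n n a b)"
    have A: "?A \<in> carrier_mat n n" unfolding averaged_def by simp
    obtain c where c: "?A = c \<cdot>\<^sub>m 1\<^sub>m n"
      using schur_scalar[OF \<rho>(1) A averaged_intertwines[OF r r]] by auto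
    have "of_nat n * c = mat_trace ?A" unfolding c by (subst mat_trace_smult[of _ n]) auto
    also have "\<dots> = (\<Sum>x\<in>carrier G. mat_trace (\<rho> x * elem_mat n n a b * \<rho> (inv x)))"
      unfolding averaged_def using repD(1)[OF r] by (intro mat_trace_mat_sum) (auto intro!: mult_carrier_mat[of _ n n])
    also have "\<dots> = (\<Sum>x\<in>carrier G. if a = b then 1 else 0)"
    proof (rule sum.cong[OF refl])
      fix x assume x: "x \<in> carrier G"
      note cc = repD(1)[OF r x] repD(1)[OF r inv_closed[OF x]]
      have "mat_trace (\<rho> x * elem_mat n n a b * \<rho> (inv x)) = mat_trace (\<rho> (inv x) * (\<rho> x * elem_mat n n a b))"
        using cc by (intro mat_trace_mult_comm[of _ n n]) (auto intro!: mult_carrier_mat[of _ n n])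
      also have "\<rho> (inv x) * (\<rho> x * elem_mat n n a b) = elem_mat n n a b"
        using cc rep_inv[OF r x] left_mult_one_mat[OF elem_mat_carrier, of n n a b]
        by (simp add: assoc_mult_mat[of _ n n _ n _ n, symmetric])
      also have "mat_trace (elem_mat n n a b) = (\<Sum>i<n. if i = a then (if a = b then 1 else 0) else 0)"
        unfolding mat_trace_def elem_mat_def by (auto intro!: sum.cong)
      also have "\<dots> = (if a = b then 1 else 0)" using ab by simp
      finally show "mat_trace (\<rho> x * elem_mat n n a b * \<rho> (inv x)) = (if a = b then 1 else 0)" .
    qed
    finally have "c = (if a = b then of_nat (card (carrier G)) / of_nat n else 0)" using n by (auto simp: field_simps)
    then show ?thesis using c ab by simp
  qed
  have "(\<Sum>a<n. \<Sum>b<n. averaged n n \<rho> \<rho> (elem_mat n n a b) $$ (a,b)) =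
    (\<Sum>a<n. \<Sum>b<n. if a = b then of_nat (card (carrier G)) / of_nat n else 0)"
    using e by (intro sum.cong refl) auto
  also have "\<dots> = (\<Sum>a<n. of_nat (card (carrier G)) / of_nat n)"
    by (intro sum.cong refl) (simp add: sum.delta')
  also have "\<dots> = of_nat (card (carrier G))" using n by simp
  finally show ?thesis using character_product_sum[OF r r] True \<rho> by simp
qed

section \<open>Irreducible constituents\<close>

text \<open>The restrictions of the \<open>\<rho> g\<close> to \<open>W\<close>, written in a basis \<open>C\<close>, multiply correctly because \<open>C\<close> can
  be cancelled on the left.\<close>

lemma subrepresentation:
  assumes \<rho>: "representation G n \<rho>" and W: "invariant_subspace G n \<rho> W"
  obtains r C \<sigma> where "representation G r \<sigma>" "C \<in> carrier_mat n r" "injective_mat C"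
    "{C *\<^sub>v v | v. v \<in> carrier_vec r} = W" "intertwines G \<rho> C \<sigma>"
proof -
  have Wl: "vec_subspace n W" using W unfolding invariant_subspace_def by simp
  obtain r C where C: "C \<in> carrier_mat n r" and inj: "injective_mat C"
    and img: "{C *\<^sub>v v | v. v \<in> carrier_vec r} = W"
    using subspace_basis[OF Wl] .
  have "\<exists>B\<in>carrier_mat r r. \<rho> g * C = C * B" if g: "g \<in> carrier G" for g
    using invariant_restrict[OF C img repD(1)[OF \<rho> g]] W g unfolding invariant_subspace_def by blast
  then obtain \<sigma> where \<sigma>: "\<And>g. g \<in> carrier G \<Longrightarrow> \<sigma> g \<in> carrier_mat r r"
    and eq: "\<And>g. g \<in> carrier G \<Longrightarrow> \<rho> g * C = C * \<sigma> g" by metis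
  have cancel: "A = B" if A: "A \<in> carrier_mat r r" and B: "B \<in> carrier_mat r r" and AB: "C * A = C * B" for A B
  proof (rule mat_eqI_mult_vec[OF A B])
    fix v :: "complex vec" assume v: "v \<in> carrier_vec r"
    have Av: "A *\<^sub>v v \<in> carrier_vec r" and Bv: "B *\<^sub>v v \<in> carrier_vec r" using A B v by auto
    have "C *\<^sub>v (A *\<^sub>v v) = C *\<^sub>v (B *\<^sub>v v)"
      using assoc_mult_mat_vec[OF C A v] assoc_mult_mat_vec[OF C B v] AB by simp
    moreover have "C *\<^sub>v (B *\<^sub>v v) \<in> carrier_vec n" using C by (intro mult_mat_vec_carrier[OF C Bv])
    ultimately have "C *\<^sub>v (A *\<^sub>v v - B *\<^sub>v v) = 0\<^sub>v n"
      using mult_minus_distrib_mat_vec[OF C Av Bv] by simp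
    then have z: "A *\<^sub>v v - B *\<^sub>v v = 0\<^sub>v r" using injective_matD[OF inj C] Av Bv by simp
    show "A *\<^sub>v v = B *\<^sub>v v"
    proof (rule eq_vecI)
      fix i assume i: "i < dim_vec (B *\<^sub>v v)"
      have "(A *\<^sub>v v - B *\<^sub>v v) $ i = 0" using z i B by simp
      then show "(A *\<^sub>v v) $ i = (B *\<^sub>v v) $ i" using i by simp
    qed (use A B in simp)
  qed
  have "representation G r \<sigma>"
    unfolding representation_iff
  proof (intro conjI ballI)
    fix g h assume g: "g \<in> carrier G" and h: "h \<in> carrier G"
    note cc = repD(1)[OF \<rho> g] repD(1)[OF \<rho> h] \<sigma>[OF g] \<sigma>[OF h]
    have "C * \<sigma> (g \<otimes> h) = (\<rho> g * \<rho> h) * C" using eq[of "g \<otimes> h"] repD(2)[OF \<rho> g h] g h by simp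
    also have "\<dots> = \<rho> g * (\<rho> h * C)" using cc C by (intro assoc_mult_mat) auto
    also have "\<dots> = \<rho> g * (C * \<sigma> h)" using eq h by simp
    also have "\<dots> = (\<rho> g * C) * \<sigma> h" using cc C by (intro assoc_mult_mat[symmetric]) auto
    also have "\<dots> = (C * \<sigma> g) * \<sigma> h" using eq g by simp
    also have "\<dots> = C * (\<sigma> g * \<sigma> h)" using cc C by (intro assoc_mult_mat) auto
    finally have "C * \<sigma> (g \<otimes> h) = C * (\<sigma> g * \<sigma> h)" .
    then show "\<sigma> (g \<otimes> h) = \<sigma> g * \<sigma> h"
      using cc \<sigma> g h by (intro cancel[of "\<sigma> (g \<otimes> h)" "\<sigma> g * \<sigma> h"]) (auto intro: mult_carrier_mat)
  next
    have "C * \<sigma> \<one> = C * 1\<^sub>m r" using eq[of \<one>] repD(3)[OF \<rho>] C by simp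
    then show "\<sigma> \<one> = 1\<^sub>m r" using \<sigma> by (intro cancel[of "\<sigma> \<one>" "1\<^sub>m r"]) auto
  qed (rule \<sigma>)
  then show thesis using that C inj img eq unfolding intertwines_def by blast
qed

lemma intertwines_mult:
  assumes C: "C \<in> carrier_mat n r" and D: "D \<in> carrier_mat r s"
    and \<rho>: "representation G n \<rho>" and \<sigma>: "representation G r \<sigma>" and \<tau>: "representation G s \<tau>"
    and "intertwines G \<rho> C \<sigma>" "intertwines G \<sigma> D \<tau>"
  shows "intertwines G \<rho> (C * D) \<tau>"
  unfolding intertwines_def
proof
  fix g assume g: "g \<in> carrier G"
  note cc = repD(1)[OF \<rho> g] repD(1)[OF \<sigma> g] repD(1)[OF \<tau> g]
  have "\<rho> g * (C * D) = (\<rho> g * C) * D" using cc C D by (intro assoc_mult_mat[symmetric]) auto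
  also have "\<dots> = (C * \<sigma> g) * D" using assms(6) g unfolding intertwines_def by simp
  also have "\<dots> = C * (\<sigma> g * D)" using cc C D by (intro assoc_mult_mat) auto
  also have "\<dots> = C * (D * \<tau> g)" using assms(7) g unfolding intertwines_def by simp
  also have "\<dots> = (C * D) * \<tau> g" using cc C D by (intro assoc_mult_mat[symmetric]) auto
  finally show "\<rho> g * (C * D) = C * D * \<tau> g" .
qed

text \<open>A reducible representation has a subrepresentation of smaller positive degree, so induction on
  the degree applies.\<close>

lemma irreducible_constituent:
  "representation G n \<rho> \<Longrightarrow> n > 0 \<Longrightarrow>
    \<exists>r C \<sigma>. irreducible_representation G r \<sigma> \<and> C \<in> carrier_mat n r \<and> injective_mat C \<and> intertwines G \<rho> C \<sigma>"
proof (induction n arbitrary: \<rho> rule: less_induct)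
  case (less n)
  note \<rho> = less.prems(1)
  show ?case
  proof (cases "irreducible_representation G n \<rho>")
    case True
    have "injective_mat (1\<^sub>m n)" unfolding injective_mat_def by auto
    moreover have "intertwines G \<rho> (1\<^sub>m n) \<rho>"
      unfolding intertwines_def using repD(1)[OF \<rho>]
      by (simp add: right_mult_one_mat[of _ n n] left_mult_one_mat[of _ n n])
    ultimately show ?thesis using True one_carrier_mat by blast
  next
    case False
    then obtain W where W: "invariant_subspace G n \<rho> W" "W \<noteq> {0\<^sub>v n}" "W \<noteq> carrier_vec n"
      using less.prems unfolding irreducible_iff by blast
    obtain r C \<sigma> where \<sigma>: "representation G r \<sigma>" and C: "C \<in> carrier_mat n r" "injective_mat C"
      and img: "{C *\<^sub>v v | v. v \<in> carrier_vec r} = W" and i: "intertwines G \<rho> C \<sigma>"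
      using subrepresentation[OF \<rho> W(1)] .
    have "r \<noteq> n"
    proof
      assume rn: "r = n"
      have "carrier_vec n \<subseteq> W"
      proof
        fix w :: "complex vec" assume "w \<in> carrier_vec n"
        then obtain v where "v \<in> carrier_vec n" "C *\<^sub>v v = w"
          using injective_mat_square_surj[of C n w] C rn by blast
        then show "w \<in> W" using img rn by blast
      qed
      moreover have "W \<subseteq> carrier_vec n" using W(1) unfolding invariant_subspace_def vec_subspace_def by blast
      ultimately show False using W(3) by blast
    qed
    then have rn: "r < n" using injective_mat_le[OF C] by simp
    have "r > 0" by (rule subspace_basis_dim_pos[OF C(1) img W(2)])
    from less.IH[OF rn \<sigma> this] obtain s D \<tau> where \<tau>: "irreducible_representation G s \<tau>"
      and D: "D \<in> carrier_mat r s" "injective_mat D" and j: "intertwines G \<sigma> D \<tau>" by blast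
    show ?thesis
      using \<tau> injective_mat_mult[OF C D] intertwines_mult[OF C(1) D(1) \<rho> \<sigma> irreducible_rep[OF \<tau>] i j]
        mult_carrier_mat[OF C(1) D(1)] by blast
  qed
qed

section \<open>Completeness of the irreducible characters\<close>

text \<open>The action of the group algebra element with coefficients \<open>f\<close>. For a class function this
  element is central.\<close>

definition group_algebra_mat :: "nat \<Rightarrow> ('a \<Rightarrow> complex mat) \<Rightarrow> ('a \<Rightarrow> complex) \<Rightarrow> complex mat" where
  "group_algebra_mat n \<rho> f = mat_sum n n (carrier G) (\<lambda>x. f x \<cdot>\<^sub>m \<rho> x)"

definition class_function :: "('a \<Rightarrow> complex) \<Rightarrow> bool" where
  "class_function f \<longleftrightarrow> (\<forall>g\<in>carrier G. \<forall>x\<in>carrier G. f (g \<otimes> x \<otimes> inv g) = f x)"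

lemma class_function_inv:
  assumes f: "class_function f"
  shows "class_function (\<lambda>x. f (inv x))"
  unfolding class_function_def
proof (intro ballI)
  fix g x assume gx: "g \<in> carrier G" "x \<in> carrier G"
  have "inv (g \<otimes> x \<otimes> inv g) = g \<otimes> inv x \<otimes> inv g" using gx by (simp add: inv_mult_group m_assoc)
  then show "f (inv (g \<otimes> x \<otimes> inv g)) = f (inv x)" using f gx unfolding class_function_def by simp
qed

lemma group_algebra_mat_carrier [simp]: "group_algebra_mat n \<rho> f \<in> carrier_mat n n"
  unfolding group_algebra_mat_def by simp

lemma bij_betw_conj:
  assumes g: "g \<in> carrier G"
  shows "bij_betw (\<lambda>x. g \<otimes> x \<otimes> inv g) (carrier G) (carrier G)"
proof (rule bij_betw_byWitness[where f' = "\<lambda>x. inv g \<otimes> x \<otimes> g"])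
  show "\<forall>x\<in>carrier G. inv g \<otimes> (g \<otimes> x \<otimes> inv g) \<otimes> g = x"
    "\<forall>x\<in>carrier G. g \<otimes> (inv g \<otimes> x \<otimes> g) \<otimes> inv g = x"
    using g by (auto simp: m_assoc[symmetric]) (auto simp: m_assoc)
qed (use g in auto)

lemma trace_group_op:
  assumes \<rho>: "representation G n \<rho>"
  shows "mat_trace (group_algebra_mat n \<rho> f) = (\<Sum>x\<in>carrier G. f x * rep_character G \<rho> x)"
  unfolding group_algebra_mat_def
  by (subst mat_trace_mat_sum)
    (auto simp: rep_character_def mat_trace_smult[OF repD(1)[OF \<rho>]] repD(1)[OF \<rho>] intro!: sum.cong)

lemma group_algebra_mat_central:
  assumes \<rho>: "representation G n \<rho>" and f: "class_function f"
  shows "intertwines G \<rho> (group_algebra_mat n \<rho> f) \<rho>"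
  unfolding intertwines_def
proof
  fix g assume g: "g \<in> carrier G"
  note \<rho>c = repD(1)[OF \<rho>]
  have "\<rho> g * group_algebra_mat n \<rho> f = mat_sum n n (carrier G) (\<lambda>x. \<rho> g * (f x \<cdot>\<^sub>m \<rho> x))"
    unfolding group_algebra_mat_def by (rule mult_mat_sum[OF \<rho>c[OF g]]) (use \<rho>c in auto)
  also have "\<dots> = mat_sum n n (carrier G) (\<lambda>x. (f (g \<otimes> x \<otimes> inv g) \<cdot>\<^sub>m \<rho> (g \<otimes> x \<otimes> inv g)) * \<rho> g)"
  proof (rule mat_sum_cong)
    fix x assume x: "x \<in> carrier G"
    have "\<rho> g * (f x \<cdot>\<^sub>m \<rho> x) = f x \<cdot>\<^sub>m \<rho> (g \<otimes> x)"
      using mult_smult_distrib[OF \<rho>c[OF g] \<rho>c[OF x]] repD(2)[OF \<rho> g x] by simp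
    also have "g \<otimes> x = (g \<otimes> x \<otimes> inv g) \<otimes> g" using g x by (simp add: m_assoc)
    also have "\<rho> \<dots> = \<rho> (g \<otimes> x \<otimes> inv g) * \<rho> g" using g x by (intro repD(2)[OF \<rho>]) auto
    finally show "\<rho> g * (f x \<cdot>\<^sub>m \<rho> x) = (f (g \<otimes> x \<otimes> inv g) \<cdot>\<^sub>m \<rho> (g \<otimes> x \<otimes> inv g)) * \<rho> g"
      using f g x mult_smult_assoc_mat[OF \<rho>c[of "g \<otimes> x \<otimes> inv g"] \<rho>c[OF g]]
      unfolding class_function_def by simp
  qed
  also have "\<dots> = mat_sum n n (carrier G) (\<lambda>x. (f x \<cdot>\<^sub>m \<rho> x) * \<rho> g)"
    by (rule mat_sum_reindex[OF bij_betw_conj[OF g], symmetric])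
  also have "\<dots> = group_algebra_mat n \<rho> f * \<rho> g"
    unfolding group_algebra_mat_def by (rule mat_sum_mult[OF \<rho>c[OF g], symmetric]) (use \<rho>c in auto)
  finally show "\<rho> g * group_algebra_mat n \<rho> f = group_algebra_mat n \<rho> f * \<rho> g" .
qed

text \<open>By Schur's lemma the matrix is scalar, and its trace is the given sum.\<close>

lemma group_algebra_mat_irreducible_eq_0:
  assumes \<rho>: "irreducible_representation G n \<rho>" and f: "class_function f"
    and orth: "\<And>\<theta>. \<theta> \<in> Irr G \<Longrightarrow> (\<Sum>x\<in>carrier G. f x * \<theta> x) = 0"
  shows "group_algebra_mat n \<rho> f = 0\<^sub>m n n"
proof -
  have n: "n > 0" using \<rho> unfolding irreducible_iff by simp
  obtain c where c: "group_algebra_mat n \<rho> f = c \<cdot>\<^sub>m 1\<^sub>m n"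
    using schur_scalar[OF \<rho> _ group_algebra_mat_central[OF irreducible_rep[OF \<rho>] f]] by auto
  have "rep_character G \<rho> \<in> Irr G" using \<rho> unfolding Irr_def by blast
  then have "mat_trace (group_algebra_mat n \<rho> f) = 0" using trace_group_op[OF irreducible_rep[OF \<rho>]] orth by simp
  then have "c = 0" unfolding c using n by (simp add: mat_trace_smult[of _ n])
  then show ?thesis unfolding c by (intro eq_matI) auto
qed

text \<open>Every eigenvalue of the matrix is \<open>0\<close>: the eigenspace of an eigenvalue \<open>c\<close> is invariant, since the
  matrix is central, and so it contains an irreducible subrepresentation. The matrix acts there as
  \<open>c\<close>, but also as \<open>0\<close> by the irreducible case.\<close>

lemma group_algebra_mat_trace_eq_0:
  assumes \<rho>: "representation G n \<rho>" and f: "class_function f"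
    and orth: "\<And>\<theta>. \<theta> \<in> Irr G \<Longrightarrow> (\<Sum>x\<in>carrier G. f x * \<theta> x) = 0"
  shows "mat_trace (group_algebra_mat n \<rho> f) = 0"
proof -
  let ?A = "group_algebra_mat n \<rho> f"
  have A: "?A \<in> carrier_mat n n" by simp
  have ev: "c = 0" if "eigenvalue ?A c" for c
  proof (rule ccontr)
    assume c0: "c \<noteq> 0"
    let ?W = "{v \<in> carrier_vec n. ?A *\<^sub>v v = c \<cdot>\<^sub>v v}"
    obtain v where v: "v \<in> ?W" "v \<noteq> 0\<^sub>v n"
      using \<open>eigenvalue ?A c\<close> A unfolding eigenvalue_def eigenvector_def by auto
    have W: "invariant_subspace G n \<rho> ?W"
      by (rule commuting_eigenspace_invariant[OF \<rho> A group_algebra_mat_central[OF \<rho> f]])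
    obtain r C \<sigma> where \<sigma>: "representation G r \<sigma>" and C: "C \<in> carrier_mat n r" "injective_mat C"
      and img: "{C *\<^sub>v v | v. v \<in> carrier_vec r} = ?W" and i: "intertwines G \<rho> C \<sigma>"
      using subrepresentation[OF \<rho> W] .
    have "?W \<noteq> {0\<^sub>v n}" using v by blast
    then have "r > 0" by (rule subspace_basis_dim_pos[OF C(1) img])
    from irreducible_constituent[OF \<sigma> this] obtain s D \<tau> where \<tau>: "irreducible_representation G s \<tau>"
      and D: "D \<in> carrier_mat r s" "injective_mat D" and j: "intertwines G \<sigma> D \<tau>" by blast
    note \<tau>c = repD(1)[OF irreducible_rep[OF \<tau>]]
    define E where "E = C * D"
    have E: "E \<in> carrier_mat n s" "injective_mat E" "intertwines G \<rho> E \<tau>"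
      unfolding E_def using C D injective_mat_mult[OF C D]
        intertwines_mult[OF C(1) D(1) \<rho> \<sigma> irreducible_rep[OF \<tau>] i j] by auto
    have "?A * E = mat_sum n s (carrier G) (\<lambda>x. (f x \<cdot>\<^sub>m \<rho> x) * E)"
      unfolding group_algebra_mat_def by (rule mat_sum_mult[OF E(1)]) (use repD(1)[OF \<rho>] in auto)
    also have "\<dots> = mat_sum n s (carrier G) (\<lambda>x. E * (f x \<cdot>\<^sub>m \<tau> x))"
    proof (rule mat_sum_cong)
      fix x assume x: "x \<in> carrier G"
      show "(f x \<cdot>\<^sub>m \<rho> x) * E = E * (f x \<cdot>\<^sub>m \<tau> x)"
        using E x mult_smult_distrib[OF E(1) \<tau>c[OF x]] mult_smult_assoc_mat[OF repD(1)[OF \<rho> x] E(1)]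
        unfolding intertwines_def by simp
    qed
    also have "\<dots> = E * group_algebra_mat s \<tau> f"
      unfolding group_algebra_mat_def by (rule mult_mat_sum[OF E(1), symmetric]) (use \<tau>c in auto)
    also have "\<dots> = 0\<^sub>m n s" using group_algebra_mat_irreducible_eq_0[OF \<tau> f orth] E(1) by simp
    finally have AE: "?A * E = 0\<^sub>m n s" .
    have s: "s > 0" using \<tau> unfolding irreducible_iff by simp
    let ?u = "unit_vec s 0 :: complex vec"
    have "?u $ 0 \<noteq> 0\<^sub>v s $ 0" using s by simp
    then have u: "?u \<in> carrier_vec s" "?u \<noteq> 0\<^sub>v s" by auto
    have Du: "D *\<^sub>v ?u \<in> carrier_vec r" using mult_mat_vec_carrier[OF D(1) u(1)] .
    have "C *\<^sub>v (D *\<^sub>v ?u) \<in> ?W" unfolding img[symmetric] using Du by blast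
    moreover have Eu: "E *\<^sub>v ?u = C *\<^sub>v (D *\<^sub>v ?u)" unfolding E_def using assoc_mult_mat_vec[OF C(1) D(1) u(1)] .
    ultimately have "?A *\<^sub>v (E *\<^sub>v ?u) = c \<cdot>\<^sub>v (E *\<^sub>v ?u)" by simp
    moreover have "?A *\<^sub>v (E *\<^sub>v ?u) = 0\<^sub>v n"
    proof -
      have "?A *\<^sub>v (E *\<^sub>v ?u) = 0\<^sub>m n s *\<^sub>v ?u" using assoc_mult_mat_vec[OF A E(1) u(1)] AE by simp
      also have "\<dots> = 0\<^sub>v n" by (intro eq_vecI) (auto simp: scalar_prod_def)
      finally show ?thesis .
    qed
    ultimately have z: "c \<cdot>\<^sub>v (E *\<^sub>v ?u) = 0\<^sub>v n" by simp
    have Euc: "E *\<^sub>v ?u \<in> carrier_vec n" using mult_mat_vec_carrier[OF E(1) u(1)] .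
    have "E *\<^sub>v ?u \<noteq> 0\<^sub>v n" using injective_matD[OF E(2,1) u(1)] u(2) by blast
    then obtain k where k: "k < n" "(E *\<^sub>v ?u) $ k \<noteq> 0"
      using vec_nonzero_entry[OF Euc] by blast
    have "(c \<cdot>\<^sub>v (E *\<^sub>v ?u)) $ k = c * (E *\<^sub>v ?u) $ k"
      by (rule index_smult_vec(1)) (use k Euc in \<open>simp only: carrier_vecD\<close>)
    moreover have "(c \<cdot>\<^sub>v (E *\<^sub>v ?u)) $ k = 0" unfolding z using k by simp
    ultimately show False using c0 k(2) by simp
  qed
  obtain es where es: "mat_trace ?A = sum_list es" "length es = n" "\<And>c. c \<in> set es \<longleftrightarrow> eigenvalue ?A c"
    using mat_trace_eigenvalues[OF A] by metis
  have "(\<forall>c\<in>set l. c = 0) \<longrightarrow> sum_list l = 0" for l :: "complex list" by (induction l) auto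
  then have "sum_list es = 0" using es(3) ev by blast
  then show ?thesis using es(1) by simp
qed

text \<open>\<open>G\<close> permutes itself by left multiplication, and only \<open>\<one>\<close> has fixed points.\<close>

lemma regular_representation:
  obtains \<rho> where "representation G (card (carrier G)) \<rho>"
    "\<And>x. x \<in> carrier G \<Longrightarrow> rep_character G \<rho> x = (if x = \<one> then of_nat (card (carrier G)) else 0)"
proof -
  define n where "n = card (carrier G)"
  obtain e where e: "bij_betw e {..<n} (carrier G)"
    using ex_bij_betw_nat_finite[OF fin] unfolding n_def atLeast0LessThan by blast
  have ec: "i < n \<Longrightarrow> e i \<in> carrier G" for i using e unfolding bij_betw_def by auto
  have einj: "i < n \<Longrightarrow> j < n \<Longrightarrow> e i = e j \<longleftrightarrow> i = j" for i j
    using e unfolding bij_betw_def inj_on_def by auto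
  define \<rho> where "\<rho> g = (mat n n (\<lambda>(i,j). if e i = g \<otimes> e j then 1 else 0) :: complex mat)" for g
  have c: "\<rho> g \<in> carrier_mat n n" for g unfolding \<rho>_def by simp
  have "representation G n \<rho>"
    unfolding representation_iff
  proof (intro conjI ballI c)
    fix g h assume g: "g \<in> carrier G" and h: "h \<in> carrier G"
    show "\<rho> (g \<otimes> h) = \<rho> g * \<rho> h"
    proof (rule eq_matI)
      fix i j assume "i < dim_row (\<rho> g * \<rho> h)" "j < dim_col (\<rho> g * \<rho> h)"
      then have ij: "i < n" "j < n" using c by (auto simp: \<rho>_def)
      have "h \<otimes> e j \<in> e ` {..<n}" using e h ec[OF ij(2)] unfolding bij_betw_def by auto
      \<comment> \<open>The sum in the matrix product has a single nonzero term, at the index of \<open>h \<otimes> e j\<close>.\<close>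
      then obtain l0 where l0: "l0 < n" "e l0 = h \<otimes> e j" by auto
      have "(\<rho> g * \<rho> h) $$ (i,j) = (\<Sum>l<n. \<rho> g $$ (i,l) * \<rho> h $$ (l,j))"
        using ij c[of g] c[of h] by (auto simp: scalar_prod_def atLeast0LessThan)
      also have "\<dots> = (\<Sum>l<n. if l = l0 then (if e i = g \<otimes> e l0 then 1 else 0) else 0)"
        using ij l0 by (intro sum.cong refl) (auto simp: \<rho>_def l0(2)[symmetric] einj)
      also have "\<dots> = (if e i = g \<otimes> e l0 then 1 else 0)" using l0 by simp
      also have "\<dots> = \<rho> (g \<otimes> h) $$ (i,j)" using ij g h ec[OF ij(2)] l0 by (simp add: \<rho>_def m_assoc)
      finally show "\<rho> (g \<otimes> h) $$ (i,j) = (\<rho> g * \<rho> h) $$ (i,j)" by simp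
    qed (auto simp: \<rho>_def)
  next
    show "\<rho> \<one> = 1\<^sub>m n" by (rule eq_matI) (auto simp: \<rho>_def ec einj)
  qed
  moreover have "rep_character G \<rho> x = (if x = \<one> then of_nat n else 0)" if x: "x \<in> carrier G" for x
  proof -
    have "e i = x \<otimes> e i \<longleftrightarrow> x = \<one>" if "i < n" for i
      using x ec[OF that] by (metis l_one one_closed r_cancel)
    then have "(\<Sum>i<n. (if e i = x \<otimes> e i then 1 else 0 :: complex)) = (\<Sum>i<n. if x = \<one> then 1 else 0)"
      by (intro sum.cong) auto
    then show ?thesis using x unfolding rep_character_def mat_trace_def by (simp add: \<rho>_def)
  qed
  ultimately show thesis using that unfolding n_def by blast
qed

lemma orthogonal_class_function_one:
  assumes f: "class_function f"
    and orth: "\<And>\<theta>. \<theta> \<in> Irr G \<Longrightarrow> (\<Sum>x\<in>carrier G. f x * \<theta> x) = 0"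
  shows "f \<one> = 0"
proof -
  obtain \<rho> where \<rho>: "representation G (card (carrier G)) \<rho>"
    "\<And>x. x \<in> carrier G \<Longrightarrow> rep_character G \<rho> x = (if x = \<one> then of_nat (card (carrier G)) else 0)"
    using regular_representation by metis
  have "0 = (\<Sum>x\<in>carrier G. f x * rep_character G \<rho> x)"
    using group_algebra_mat_trace_eq_0[OF \<rho>(1) f orth] trace_group_op[OF \<rho>(1), of f] by simp
  also have "\<dots> = (\<Sum>x\<in>carrier G. if x = \<one> then f \<one> * of_nat (card (carrier G)) else 0)"
    using \<rho>(2) by (intro sum.cong) auto
  also have "\<dots> = f \<one> * of_nat (card (carrier G))" using fin by simp
  finally show ?thesis using fin one_closed by (auto simp: card_eq_0_iff)
qed

text \<open>Completeness of the irreducible characters. On the regular representation the trace of the group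
  algebra element \<open>f\<close> is \<open>|G| f(\<one>)\<close>, which gives \<open>f(\<one>) = 0\<close>. For the other values, apply this to the
  convolution \<open>k\<close> of \<open>f\<close> with \<open>y \<mapsto> cnj (f (y\<^sup>-\<^sup>1))\<close>: it is again a class function, it is again
  orthogonal to the irreducible characters since \<open>f\<close> acts as \<open>0\<close> on every irreducible
  representation, and \<open>k(\<one>)\<close> is the sum of all \<open>|f(x)|\<^sup>2\<close>.\<close>

theorem orthogonal_class_function:
  assumes f: "class_function f"
    and orth: "\<And>\<theta>. \<theta> \<in> Irr G \<Longrightarrow> (\<Sum>x\<in>carrier G. f x * \<theta> x) = 0"
    and g: "g \<in> carrier G"
  shows "f g = 0"
proof -
  \<comment> \<open>The convolution of \<open>f\<close> with \<open>y \<mapsto> cnj (f (inv y))\<close>.\<close>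
  define k where "k y = (\<Sum>x\<in>carrier G. f x * cnj (f (inv y \<otimes> x)))" for y
  have "class_function k"
    unfolding class_function_def
  proof (intro ballI)
    fix h y assume h: "h \<in> carrier G" and y: "y \<in> carrier G"
    have "k (h \<otimes> y \<otimes> inv h) = (\<Sum>x\<in>carrier G. f (h \<otimes> x \<otimes> inv h) * cnj (f (inv (h \<otimes> y \<otimes> inv h) \<otimes> (h \<otimes> x \<otimes> inv h))))"
      unfolding k_def by (rule sum.reindex_bij_betw[OF bij_betw_conj[OF h], symmetric])
    also have "\<dots> = (\<Sum>x\<in>carrier G. f x * cnj (f (inv y \<otimes> x)))"
    proof (rule sum.cong[OF refl])
      fix x assume x: "x \<in> carrier G"
      have "inv (h \<otimes> y \<otimes> inv h) \<otimes> (h \<otimes> x \<otimes> inv h) = h \<otimes> (inv y \<otimes> x) \<otimes> inv h"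
        using h x y by (simp add: inv_mult_group m_assoc) (simp add: m_assoc[symmetric])
      then show "f (h \<otimes> x \<otimes> inv h) * cnj (f (inv (h \<otimes> y \<otimes> inv h) \<otimes> (h \<otimes> x \<otimes> inv h))) = f x * cnj (f (inv y \<otimes> x))"
        using f h x y unfolding class_function_def by simp
    qed
    finally show "k (h \<otimes> y \<otimes> inv h) = k y" unfolding k_def .
  qed
  moreover have "(\<Sum>y\<in>carrier G. k y * \<theta> y) = 0" if \<theta>: "\<theta> \<in> Irr G" for \<theta>
  proof -
    obtain n \<rho> where \<rho>: "irreducible_representation G n \<rho>" "\<theta> = rep_character G \<rho>" using \<theta> unfolding Irr_def by blast
    note r = irreducible_rep[OF \<rho>(1)]
    have bij: "bij_betw (\<lambda>y. x \<otimes> inv y) (carrier G) (carrier G)" if "x \<in> carrier G" for x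
      using bij_betw_trans[OF bij_betw_inv bij_betw_left_mult[OF that]] by (simp add: o_def)
    have "(\<Sum>y\<in>carrier G. k y * \<theta> y) = (\<Sum>y\<in>carrier G. \<Sum>x\<in>carrier G. f x * cnj (f (inv y \<otimes> x)) * \<theta> y)"
      unfolding k_def by (simp add: sum_distrib_right)
    also have "\<dots> = (\<Sum>x\<in>carrier G. \<Sum>y\<in>carrier G. f x * cnj (f (inv y \<otimes> x)) * \<theta> y)" by (rule sum.swap)
    also have "\<dots> = (\<Sum>x\<in>carrier G. \<Sum>y\<in>carrier G. f x * cnj (f y) * \<theta> (x \<otimes> inv y))"
    proof (rule sum.cong[OF refl])
      fix x assume x: "x \<in> carrier G"
      have "(\<Sum>y\<in>carrier G. f x * cnj (f (inv y \<otimes> x)) * \<theta> y) =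
        (\<Sum>y\<in>carrier G. f x * cnj (f (inv (x \<otimes> inv y) \<otimes> x)) * \<theta> (x \<otimes> inv y))"
        by (rule sum.reindex_bij_betw[OF bij[OF x], symmetric])
      also have "\<dots> = (\<Sum>y\<in>carrier G. f x * cnj (f y) * \<theta> (x \<otimes> inv y))"
        using x by (intro sum.cong refl) (simp add: inv_mult_group m_assoc)
      finally show "(\<Sum>y\<in>carrier G. f x * cnj (f (inv y \<otimes> x)) * \<theta> y) = (\<Sum>y\<in>carrier G. f x * cnj (f y) * \<theta> (x \<otimes> inv y))" .
    qed
    also have "\<dots> = (\<Sum>y\<in>carrier G. \<Sum>x\<in>carrier G. f x * cnj (f y) * \<theta> (x \<otimes> inv y))" by (rule sum.swap)
    also have "\<dots> = (\<Sum>y\<in>carrier G. cnj (f y) * mat_trace (group_algebra_mat n \<rho> f * \<rho> (inv y)))"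
    proof (rule sum.cong[OF refl])
      fix y assume y: "y \<in> carrier G"
      have yc: "\<rho> (inv y) \<in> carrier_mat n n" using repD(1)[OF r] y by simp
      have "group_algebra_mat n \<rho> f * \<rho> (inv y) = mat_sum n n (carrier G) (\<lambda>x. (f x \<cdot>\<^sub>m \<rho> x) * \<rho> (inv y))"
        unfolding group_algebra_mat_def by (rule mat_sum_mult[OF yc]) (use repD(1)[OF r] in auto)
      also have "mat_trace \<dots> = (\<Sum>x\<in>carrier G. mat_trace ((f x \<cdot>\<^sub>m \<rho> x) * \<rho> (inv y)))"
        by (rule mat_trace_mat_sum) (use repD(1)[OF r] yc in \<open>auto intro!: mult_carrier_mat[of _ n n]\<close>)
      also have "\<dots> = (\<Sum>x\<in>carrier G. f x * \<theta> (x \<otimes> inv y))"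
      proof (rule sum.cong[OF refl])
        fix x assume x: "x \<in> carrier G"
        have "(f x \<cdot>\<^sub>m \<rho> x) * \<rho> (inv y) = f x \<cdot>\<^sub>m \<rho> (x \<otimes> inv y)"
          using mult_smult_assoc_mat[OF repD(1)[OF r x] yc] repD(2)[OF r x, of "inv y"] y by simp
        then show "mat_trace ((f x \<cdot>\<^sub>m \<rho> x) * \<rho> (inv y)) = f x * \<theta> (x \<otimes> inv y)"
          using x y repD(1)[OF r, of "x \<otimes> inv y"] \<rho>(2) unfolding rep_character_def
          by (simp add: mat_trace_smult[of _ n])
      qed
      finally show "(\<Sum>x\<in>carrier G. f x * cnj (f y) * \<theta> (x \<otimes> inv y)) =
        cnj (f y) * mat_trace (group_algebra_mat n \<rho> f * \<rho> (inv y))"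
        by (simp add: sum_distrib_left mult_ac)
    qed
    also have "\<dots> = 0"
    proof (rule sum.neutral, rule ballI)
      fix y assume y: "y \<in> carrier G"
      have "group_algebra_mat n \<rho> f * \<rho> (inv y) = 0\<^sub>m n n"
        using group_algebra_mat_irreducible_eq_0[OF \<rho>(1) f orth] repD(1)[OF r, of "inv y"] y by simp
      then show "cnj (f y) * mat_trace (group_algebra_mat n \<rho> f * \<rho> (inv y)) = 0" by (simp add: mat_trace_def)
    qed
    finally show ?thesis .
  qed
  ultimately have "k \<one> = 0" by (rule orthogonal_class_function_one)
  then have "(\<Sum>x\<in>carrier G. f x * cnj (f x)) = 0" unfolding k_def by simp
  moreover have "complex_of_real (\<Sum>x\<in>carrier G. (norm (f x))\<^sup>2) = (\<Sum>x\<in>carrier G. f x * cnj (f x))"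
    unfolding of_real_sum complex_norm_square ..
  ultimately have "complex_of_real (\<Sum>x\<in>carrier G. (norm (f x))\<^sup>2) = 0" by simp
  then have "(\<Sum>x\<in>carrier G. (norm (f x))\<^sup>2) = 0" using of_real_eq_0_iff by blast
  then show ?thesis using g fin by (simp add: sum_nonneg_eq_0_iff)
qed

section \<open>Kernels of characters and sums over normal subgroups\<close>

lemma IrrE:
  assumes "\<chi> \<in> Irr G"
  obtains n \<rho> where "irreducible_representation G n \<rho>" "representation G n \<rho>" "n > 0"
    "\<chi> = rep_character G \<rho>" "\<forall>g\<in>carrier G. \<chi> g = mat_trace (\<rho> g)" "\<chi> \<one> = of_nat n"
proof -
  obtain n \<rho> where \<rho>: "irreducible_representation G n \<rho>" "\<chi> = rep_character G \<rho>"
    using assms unfolding Irr_def by blast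
  have c: "\<forall>g\<in>carrier G. \<chi> g = mat_trace (\<rho> g)"
    using \<rho>(2) unfolding rep_character_def by simp
  moreover have "\<chi> \<one> = of_nat n" using c repD(3)[OF irreducible_rep[OF \<rho>(1)]] by simp
  moreover have "n > 0" using \<rho>(1) unfolding irreducible_iff by simp
  ultimately show thesis using that \<rho> irreducible_rep[OF \<rho>(1)] by blast
qed

lemma irr_one_neq_0: "\<chi> \<in> Irr G \<Longrightarrow> \<chi> \<one> \<noteq> 0"
  by (elim IrrE) simp

lemma irr_class_function:
  assumes "\<chi> \<in> Irr G"
  shows "class_function \<chi>"
  unfolding class_function_def
proof (intro ballI)
  fix g x assume g: "g \<in> carrier G" and x: "x \<in> carrier G"
  obtain n \<rho> where \<rho>: "representation G n \<rho>" and c0: "\<forall>g\<in>carrier G. \<chi> g = mat_trace (\<rho> g)"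
    using assms by (rule IrrE) blast
  note c = bspec[OF c0]
  note cc = repD(1)[OF \<rho> g] repD(1)[OF \<rho> x] repD(1)[OF \<rho> inv_closed[OF g]]
  have "\<chi> (g \<otimes> x \<otimes> inv g) = mat_trace (\<rho> g * \<rho> x * \<rho> (inv g))"
    using c[of "g \<otimes> x \<otimes> inv g"] g x repD(2)[OF \<rho>, of "g \<otimes> x" "inv g"] repD(2)[OF \<rho> g x] by simp
  also have "\<dots> = mat_trace (\<rho> (inv g) * (\<rho> g * \<rho> x))"
    using cc by (intro mat_trace_mult_comm[of _ n n]) (auto intro: mult_carrier_mat)
  also have "\<rho> (inv g) * (\<rho> g * \<rho> x) = (\<rho> (inv g) * \<rho> g) * \<rho> x"
    using cc by (intro assoc_mult_mat[symmetric]) auto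
  also have "\<dots> = \<rho> x" using rep_inv(2)[OF \<rho> g] cc(2) by simp
  finally show "\<chi> (g \<otimes> x \<otimes> inv g) = \<chi> x" using c[OF x] by simp
qed

lemma rep_pow:
  assumes \<rho>: "representation G n \<rho>" and g: "g \<in> carrier G"
  shows "\<rho> (g [^] (k::nat)) = \<rho> g ^\<^sub>m k"
proof (induction k)
  case 0
  then show ?case using repD(3)[OF \<rho>] repD(1)[OF \<rho> g] by simp
next
  case (Suc k)
  then show ?case using repD(2)[OF \<rho> nat_pow_closed[OF g] g] by simp
qed

text \<open>Each \<open>\<rho> g\<close> has finite order, so its trace equals the degree only if it is the identity.\<close>

lemma char_ker_eq_rep_kernel:
  assumes \<rho>: "representation G n \<rho>"
  shows "char_ker G (rep_character G \<rho>) = {g \<in> carrier G. \<rho> g = 1\<^sub>m n}"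
proof -
  have "\<rho> g = 1\<^sub>m n" if g: "g \<in> carrier G" and tr: "mat_trace (\<rho> g) = of_nat n" for g
  proof (rule finite_order_trace_eq_dim[OF repD(1)[OF \<rho> g] _ _ tr])
    show "Coset.order G > 0" using fin order_gt_0_iff_finite by simp
    show "\<rho> g ^\<^sub>m Coset.order G = 1\<^sub>m n"
      using rep_pow[OF \<rho> g, of "Coset.order G"] pow_order_eq_1[OF g] repD(3)[OF \<rho>] by simp
  qed
  then have eq: "mat_trace (\<rho> g) = of_nat n \<longleftrightarrow> \<rho> g = 1\<^sub>m n" if "g \<in> carrier G" for g
    using that mat_trace_one[of n] by metis
  have "char_ker G (rep_character G \<rho>) = {g \<in> carrier G. mat_trace (\<rho> g) = of_nat n}"
    unfolding char_ker_def rep_character_def by (simp add: repD(3)[OF \<rho>] cong: conj_cong)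
  then show ?thesis using eq by blast
qed

lemma char_ker_normal:
  assumes "\<chi> \<in> Irr G"
  shows "char_ker G \<chi> \<lhd> G"
proof -
  obtain n \<rho> where \<rho>: "representation G n \<rho>" and \<chi>: "\<chi> = rep_character G \<rho>"
    using assms by (rule IrrE) blast
  have K: "char_ker G \<chi> = {g \<in> carrier G. \<rho> g = 1\<^sub>m n}"
    unfolding \<chi> by (rule char_ker_eq_rep_kernel[OF \<rho>])
  show ?thesis
    unfolding normal_inv_iff K
  proof (intro conjI ballI)
    show "subgroup {g \<in> carrier G. \<rho> g = 1\<^sub>m n} G"
    proof (rule subgroupI)
      show "{g \<in> carrier G. \<rho> g = 1\<^sub>m n} \<noteq> {}" using repD(3)[OF \<rho>] by blast
      fix a assume a: "a \<in> {g \<in> carrier G. \<rho> g = 1\<^sub>m n}"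
      then have "\<rho> (inv a) = 1\<^sub>m n" using rep_inv(1)[OF \<rho>, of a] repD(1)[OF \<rho>, of "inv a"] by simp
      then show "inv a \<in> {g \<in> carrier G. \<rho> g = 1\<^sub>m n}" using a by simp
    qed (auto simp: repD(2)[OF \<rho>])
    fix x h assume x: "x \<in> carrier G" and h: "h \<in> {g \<in> carrier G. \<rho> g = 1\<^sub>m n}"
    have "\<rho> (x \<otimes> h \<otimes> inv x) = 1\<^sub>m n"
      using x h repD(2)[OF \<rho>, of "x \<otimes> h" "inv x"] repD(2)[OF \<rho>, of x h] rep_inv(1)[OF \<rho> x] repD(1)[OF \<rho> x]
      by simp
    then show "x \<otimes> h \<otimes> inv x \<in> {g \<in> carrier G. \<rho> g = 1\<^sub>m n}" using x h by simp
  qed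
qed

lemma char_kerD: "x \<in> char_ker G \<chi> \<Longrightarrow> \<chi> x = \<chi> \<one>"
  unfolding char_ker_def by simp

lemma normal_carrier: "carrier G \<lhd> G"
  unfolding normal_inv_iff by (simp add: subgroup_self)

definition trivial_char :: "'a \<Rightarrow> complex" where
  "trivial_char = (\<lambda>g\<in>carrier G. 1)"

lemma trivial_char_irr: "trivial_char \<in> Irr G"
proof -
  let ?\<rho> = "\<lambda>g::'a. 1\<^sub>m 1 :: complex mat"
  have r: "representation G 1 ?\<rho>" unfolding representation_iff by auto
  have "W = {0\<^sub>v 1} \<or> W = carrier_vec 1" if W: "vec_subspace 1 W" for W
  proof (cases "W = {0\<^sub>v 1}")
    case False
    then obtain w where w: "w \<in> W" "w \<noteq> 0\<^sub>v 1" using W unfolding vec_subspace_def by blast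
    have wc: "w \<in> carrier_vec 1" using w W unfolding vec_subspace_def by blast
    have w0: "w $ 0 \<noteq> 0" using vec_nonzero_entry[OF wc w(2)] by auto
    have "v \<in> W" if v: "v \<in> carrier_vec 1" for v
    proof -
      have "v = (v $ 0 / w $ 0) \<cdot>\<^sub>v w" using v wc w0 by (intro eq_vecI) auto
      then show ?thesis using W w(1) unfolding vec_subspace_def by metis
    qed
    then show ?thesis using W unfolding vec_subspace_def by blast
  qed simp
  then have "irreducible_representation G 1 ?\<rho>"
    unfolding irreducible_iff invariant_subspace_def using r by auto
  moreover have "trivial_char = rep_character G ?\<rho>"
    unfolding trivial_char_def rep_character_def by simp
  ultimately show ?thesis unfolding Irr_def by blast
qed

lemma trivial_char_apply: "g \<in> carrier G \<Longrightarrow> trivial_char g = 1"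
  unfolding trivial_char_def by simp

lemma char_ker_trivial_char: "char_ker G trivial_char = carrier G"
  unfolding char_ker_def by (auto simp: trivial_char_apply)

lemma normal_facts:
  assumes "N \<lhd> G"
  shows "\<one> \<in> N" "x \<in> N \<Longrightarrow> x \<in> carrier G" "x \<in> N \<Longrightarrow> inv x \<in> N" "x \<in> N \<Longrightarrow> y \<in> N \<Longrightarrow> x \<otimes> y \<in> N"
    "x \<in> carrier G \<Longrightarrow> h \<in> N \<Longrightarrow> x \<otimes> h \<otimes> inv x \<in> N" "N \<subseteq> carrier G" "finite N" "card N > 0"
proof -
  interpret normal N G by (rule assms)
  show 1: "\<one> \<in> N" "x \<in> N \<Longrightarrow> x \<in> carrier G" "x \<in> N \<Longrightarrow> inv x \<in> N" "x \<in> N \<Longrightarrow> y \<in> N \<Longrightarrow> x \<otimes> y \<in> N"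
    "x \<in> carrier G \<Longrightarrow> h \<in> N \<Longrightarrow> x \<otimes> h \<otimes> inv x \<in> N" "N \<subseteq> carrier G"
    using inv_op_closed2 subset by auto
  show 2: "finite N" using subset fin by (rule finite_subset)
  show "card N > 0" using 1(1) 2 card_gt_0_iff by blast
qed

lemma normal_conj_iff:
  assumes N: "N \<lhd> G" and g: "g \<in> carrier G" and x: "x \<in> carrier G"
  shows "g \<otimes> x \<otimes> inv g \<in> N \<longleftrightarrow> x \<in> N"
proof
  assume "g \<otimes> x \<otimes> inv g \<in> N"
  then have "inv g \<otimes> (g \<otimes> x \<otimes> inv g) \<otimes> inv (inv g) \<in> N" by (rule normal_facts(5)[OF N inv_closed[OF g]])
  also have "inv g \<otimes> (g \<otimes> x \<otimes> inv g) \<otimes> inv (inv g) = x" using g x by (simp add: m_assoc[symmetric]) (simp add: m_assoc)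
  finally show "x \<in> N" .
qed (rule normal_facts(5)[OF N g])

text \<open>The matrix \<open>E = (\<Sum>x\<in>N. \<rho> x)\<close> commutes with the representation because \<open>N\<close> is normal, so it is
  a scalar \<open>s\<close>. Since \<open>\<rho> m * E = E\<close> for \<open>m \<in> N\<close>, a nonzero \<open>s\<close> would put all of \<open>N\<close> into the
  kernel. Hence \<open>E = 0\<close>, and the sum is the trace of \<open>\<rho> g * E\<close>.\<close>

lemma normal_coset_sum_eq_0:
  assumes N: "N \<lhd> G" and \<chi>: "\<chi> \<in> Irr G" and nker: "\<not> N \<subseteq> char_ker G \<chi>" and g: "g \<in> carrier G"
  shows "(\<Sum>x\<in>N. \<chi> (g \<otimes> x)) = 0"
proof -
  obtain n \<rho> where irr: "irreducible_representation G n \<rho>" and \<rho>: "representation G n \<rho>"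
    and \<chi>\<rho>: "\<chi> = rep_character G \<rho>" and c0: "\<forall>g\<in>carrier G. \<chi> g = mat_trace (\<rho> g)"
    using \<chi> by (rule IrrE) blast
  note c = bspec[OF c0]
  note NG = normal_facts(2)[OF N]
  have \<rho>N: "\<rho> x \<in> carrier_mat n n" if "x \<in> N" for x using repD(1)[OF \<rho> NG[OF that]] .
  define E where "E = mat_sum n n N \<rho>"
  have E: "E \<in> carrier_mat n n" unfolding E_def by simp
  have "intertwines G \<rho> E \<rho>"
    unfolding intertwines_def
  proof
    fix h assume h: "h \<in> carrier G"
    have bij: "bij_betw (\<lambda>x. h \<otimes> x \<otimes> inv h) N N"
    proof (rule bij_betw_imageI)
      show "inj_on (\<lambda>x. h \<otimes> x \<otimes> inv h) N"
        using bij_betw_conj[OF h] normal_facts(6)[OF N] unfolding bij_betw_def by (blast intro: inj_on_subset)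
      then show "(\<lambda>x. h \<otimes> x \<otimes> inv h) ` N = N"
        using normal_facts(5)[OF N h] normal_facts(7)[OF N] by (intro endo_inj_surj) auto
    qed
    have "\<rho> h * E = mat_sum n n N (\<lambda>x. \<rho> h * \<rho> x)"
      unfolding E_def by (rule mult_mat_sum[OF repD(1)[OF \<rho> h] \<rho>N])
    also have "\<dots> = mat_sum n n N (\<lambda>x. \<rho> (h \<otimes> x \<otimes> inv h) * \<rho> h)"
    proof (rule mat_sum_cong)
      fix x assume x: "x \<in> N"
      have "\<rho> (h \<otimes> x \<otimes> inv h) * \<rho> h = \<rho> (h \<otimes> x \<otimes> inv h \<otimes> h)"
        using h NG[OF x] by (intro repD(2)[OF \<rho>, symmetric]) auto
      also have "h \<otimes> x \<otimes> inv h \<otimes> h = h \<otimes> x" using h NG[OF x] by (simp add: m_assoc)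
      also have "\<rho> (h \<otimes> x) = \<rho> h * \<rho> x" by (rule repD(2)[OF \<rho> h NG[OF x]])
      finally show "\<rho> h * \<rho> x = \<rho> (h \<otimes> x \<otimes> inv h) * \<rho> h" by simp
    qed
    also have "\<dots> = mat_sum n n N (\<lambda>x. \<rho> x * \<rho> h)" by (rule mat_sum_reindex[OF bij, symmetric])
    also have "\<dots> = E * \<rho> h" unfolding E_def by (rule mat_sum_mult[OF repD(1)[OF \<rho> h] \<rho>N, symmetric])
    finally show "\<rho> h * E = E * \<rho> h" .
  qed
  from schur_scalar[OF irr E this] obtain s where s: "E = s \<cdot>\<^sub>m 1\<^sub>m n" by blast
  obtain m where m: "m \<in> N" "m \<notin> char_ker G \<chi>" using nker by blast
  have \<rho>m: "\<rho> m \<noteq> 1\<^sub>m n" using m NG[OF m(1)] char_ker_eq_rep_kernel[OF \<rho>] \<chi>\<rho> by auto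
  have mE: "\<rho> m * E = E"
  proof -
    have bij: "bij_betw (\<lambda>x. m \<otimes> x) N N"
    proof (rule bij_betw_imageI)
      show "inj_on (\<lambda>x. m \<otimes> x) N"
        using bij_betw_left_mult[OF NG[OF m(1)]] normal_facts(6)[OF N] unfolding bij_betw_def by (blast intro: inj_on_subset)
      then show "(\<lambda>x. m \<otimes> x) ` N = N"
        using normal_facts(4)[OF N m(1)] normal_facts(7)[OF N] by (intro endo_inj_surj) auto
    qed
    have "\<rho> m * E = mat_sum n n N (\<lambda>x. \<rho> m * \<rho> x)"
      unfolding E_def by (rule mult_mat_sum[OF \<rho>N[OF m(1)] \<rho>N])
    also have "\<dots> = mat_sum n n N (\<lambda>x. \<rho> (m \<otimes> x))"
      by (rule mat_sum_cong) (use repD(2)[OF \<rho>] NG m(1) in simp)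
    also have "\<dots> = E" unfolding E_def by (rule mat_sum_reindex[OF bij, symmetric])
    finally show ?thesis .
  qed
  have "s = 0"
  proof (rule ccontr)
    assume s0: "s \<noteq> 0"
    have "s \<cdot>\<^sub>m \<rho> m = s \<cdot>\<^sub>m 1\<^sub>m n"
      using mE mult_smult_distrib[OF \<rho>N[OF m(1)] one_carrier_mat, of s] \<rho>N[OF m(1)] unfolding s by simp
    then have eq: "(s \<cdot>\<^sub>m \<rho> m) $$ (i,j) = (s \<cdot>\<^sub>m 1\<^sub>m n) $$ (i,j)" for i j by simp
    have "\<rho> m $$ (i,j) = 1\<^sub>m n $$ (i,j)" if "i < n" "j < n" for i j
      using eq[of i j] that s0 \<rho>N[OF m(1)] by (auto split: if_splits)
    then have "\<rho> m = 1\<^sub>m n" using \<rho>N[OF m(1)] by (intro eq_matI) auto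
    then show False using \<rho>m by simp
  qed
  then have E0: "\<rho> g * E = 0\<^sub>m n n" using repD(1)[OF \<rho> g] unfolding s by (intro eq_matI) auto
  have "(\<Sum>x\<in>N. \<chi> (g \<otimes> x)) = (\<Sum>x\<in>N. mat_trace (\<rho> g * \<rho> x))"
    using c g NG repD(2)[OF \<rho> g] by (intro sum.cong) auto
  also have "\<dots> = mat_trace (mat_sum n n N (\<lambda>x. \<rho> g * \<rho> x))"
    by (rule mat_trace_mat_sum[symmetric]) (use repD(1)[OF \<rho> g] \<rho>N in \<open>auto intro: mult_carrier_mat\<close>)
  also have "mat_sum n n N (\<lambda>x. \<rho> g * \<rho> x) = \<rho> g * E"
    unfolding E_def by (rule mult_mat_sum[OF repD(1)[OF \<rho> g] \<rho>N, symmetric])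
  finally show ?thesis using E0 by (simp add: mat_trace_def)
qed

lemma normal_sum:
  assumes N: "N \<lhd> G" and \<chi>: "\<chi> \<in> Irr G"
  shows "(\<Sum>x\<in>N. \<chi> x) = (if N \<subseteq> char_ker G \<chi> then of_nat (card N) * \<chi> \<one> else 0)"
proof (cases "N \<subseteq> char_ker G \<chi>")
  case True
  then have "(\<Sum>x\<in>N. \<chi> x) = (\<Sum>x\<in>N. \<chi> \<one>)" by (intro sum.cong) (auto dest: char_kerD)
  then show ?thesis using True by simp
next
  case False
  have "(\<Sum>x\<in>N. \<chi> x) = (\<Sum>x\<in>N. \<chi> (\<one> \<otimes> x))" using normal_facts(2)[OF N] by (intro sum.cong) auto
  then show ?thesis using False normal_coset_sum_eq_0[OF N \<chi> False one_closed] by simp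
qed

section \<open>Characters between two normal subgroups\<close>

text \<open>Under inflation these are the irreducible characters of \<open>G/N\<close> whose kernel does not
  contain \<open>M/N\<close>.\<close>

definition irr_between :: "'a set \<Rightarrow> 'a set \<Rightarrow> ('a \<Rightarrow> complex) set" where
  "irr_between N M = {\<theta> \<in> Irr G. N \<subseteq> char_ker G \<theta> \<and> \<not> M \<subseteq> char_ker G \<theta>}"

lemma indicator_sum:
  assumes "N \<subseteq> carrier G"
  shows "(\<Sum>x\<in>carrier G. (if x \<in> N then a else 0) * \<theta> x) = a * (\<Sum>x\<in>N. \<theta> x :: complex)"
proof -
  have "(\<Sum>x\<in>carrier G. (if x \<in> N then a else 0) * \<theta> x) = (\<Sum>x\<in>carrier G. if x \<in> N then a * \<theta> x else 0)"
    by (intro sum.cong) auto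
  also have "\<dots> = (\<Sum>x\<in>carrier G \<inter> N. a * \<theta> x)" using fin by (simp add: sum.inter_restrict)
  also have "carrier G \<inter> N = N" using assms by blast
  finally show ?thesis by (simp add: sum_distrib_left)
qed

text \<open>Otherwise every irreducible character has both or neither of \<open>N\<close> and \<open>M\<close> in its kernel, and
  the class function \<open>|M| 1\<^sub>N - |N| 1\<^sub>M\<close> is orthogonal to all of them. But its value on
  \<open>M - N\<close> is \<open>-|N|\<close>.\<close>

lemma irr_between_nonempty:
  assumes N: "N \<lhd> G" and M: "M \<lhd> G" and NM: "N \<subset> M"
  shows "irr_between N M \<noteq> {}"
proof
  assume empty: "irr_between N M = {}"
  let ?f = "\<lambda>x. (if x \<in> N then of_nat (card M) else 0) - (if x \<in> M then of_nat (card N) else 0) :: complex"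
  obtain m where m: "m \<in> M" "m \<notin> N" using NM by blast
  have "?f m = 0"
  proof (rule orthogonal_class_function)
    show "class_function ?f"
      unfolding class_function_def using normal_conj_iff[OF N] normal_conj_iff[OF M] by simp
    show "m \<in> carrier G" using normal_facts(2)[OF M m(1)] .
    fix \<theta> assume \<theta>: "\<theta> \<in> Irr G"
    have "(\<Sum>x\<in>carrier G. ?f x * \<theta> x) = of_nat (card M) * (\<Sum>x\<in>N. \<theta> x) - of_nat (card N) * (\<Sum>x\<in>M. \<theta> x)"
      using indicator_sum normal_facts(6)[OF N] normal_facts(6)[OF M] by (simp add: left_diff_distrib sum_subtractf)
    also have "\<dots> = 0"
    proof -
      have "N \<subseteq> char_ker G \<theta> \<longleftrightarrow> M \<subseteq> char_ker G \<theta>"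
        using empty \<theta> NM unfolding irr_between_def by blast
      then show ?thesis unfolding normal_sum[OF N \<theta>] normal_sum[OF M \<theta>] by simp
    qed
    finally show "(\<Sum>x\<in>carrier G. ?f x * \<theta> x) = 0" .
  qed
  then show False using m normal_facts(8)[OF N] by simp
qed

text \<open>The difference of the two sides, with \<open>x\<close> inverted, is a class function. Its inner product with
  an irreducible \<open>\<theta>\<close> is \<open>0\<close> in each case: the two indicator terms contribute \<open>|G| \<theta>(\<one>)\<close> each if
  \<open>M\<close> lies in the kernel of \<open>\<theta>\<close>, nothing if \<open>N\<close> does not, and in the only remaining case
  \<open>\<theta> = \<chi>\<close> the first of them cancels against \<open>\<chi>(\<one>)\<close> times the norm \<open>|G|\<close> of \<open>\<chi>\<close>. In particular
  \<open>\<chi>\<close> vanishes outside \<open>M\<close> and is a nonzero constant on \<open>M - N\<close>.\<close>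

lemma unique_irr_between_values:
  assumes N: "N \<lhd> G" and M: "M \<lhd> G" and NM: "N \<subset> M" and \<chi>: "irr_between N M = {\<chi>}"
    and x: "x \<in> carrier G"
  shows "\<chi> \<one> * \<chi> x = (if x \<in> N then of_nat (card (carrier G)) / of_nat (card N) else 0) -
    (if x \<in> M then of_nat (card (carrier G)) / of_nat (card M) else 0)"
proof -
  let ?a = "of_nat (card (carrier G)) / of_nat (card N) :: complex"
  let ?b = "of_nat (card (carrier G)) / of_nat (card M) :: complex"
  let ?f = "\<lambda>x. (if x \<in> N then ?a else 0) - (if x \<in> M then ?b else 0) - \<chi> \<one> * \<chi> (inv x)"
  have \<chi>I: "\<chi> \<in> Irr G" "N \<subseteq> char_ker G \<chi>" "\<not> M \<subseteq> char_ker G \<chi>" using \<chi> unfolding irr_between_def by auto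
  have x': "inv x \<in> carrier G" using x by simp
  have "?f (inv x) = 0"
  proof (rule orthogonal_class_function[OF _ _ x'])
    show "class_function ?f"
      using class_function_inv[OF irr_class_function[OF \<chi>I(1)]] normal_conj_iff[OF N] normal_conj_iff[OF M]
      unfolding class_function_def by simp
    fix \<theta> assume \<theta>: "\<theta> \<in> Irr G"
    have "(\<Sum>x\<in>carrier G. ?f x * \<theta> x) = (\<Sum>x\<in>carrier G. (if x \<in> N then ?a else 0) * \<theta> x)
        - (\<Sum>x\<in>carrier G. (if x \<in> M then ?b else 0) * \<theta> x)
        - (\<Sum>x\<in>carrier G. \<chi> \<one> * (\<theta> x * \<chi> (inv x)))"
      unfolding sum_subtractf[symmetric] by (intro sum.cong refl) (simp only: left_diff_distrib, simp only: mult_ac)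
    also have "\<dots> = ?a * (\<Sum>x\<in>N. \<theta> x) - ?b * (\<Sum>x\<in>M. \<theta> x)
        - \<chi> \<one> * (\<Sum>x\<in>carrier G. \<theta> x * \<chi> (inv x))"
      unfolding indicator_sum[OF normal_facts(6)[OF N]] indicator_sum[OF normal_facts(6)[OF M]] sum_distrib_left ..
    also have "\<dots> = 0"
    proof (cases "\<theta> = \<chi>")
      case True
      then show ?thesis
        unfolding row_orthogonality[OF \<theta> \<chi>I(1)] normal_sum[OF N \<theta>] normal_sum[OF M \<theta>]
        using \<chi>I normal_facts(8)[OF N] by simp
    next
      case False
      then have "\<theta> \<notin> irr_between N M" using \<chi> by simp
      then have "N \<subseteq> char_ker G \<theta> \<longleftrightarrow> M \<subseteq> char_ker G \<theta>" using \<theta> NM unfolding irr_between_def by blast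
      then show ?thesis
        unfolding row_orthogonality[OF \<theta> \<chi>I(1)] normal_sum[OF N \<theta>] normal_sum[OF M \<theta>]
        using False normal_facts(8)[OF N] normal_facts(8)[OF M] by simp
    qed
    finally show "(\<Sum>x\<in>carrier G. ?f x * \<theta> x) = 0" .
  qed
  moreover have "inv x \<in> N \<longleftrightarrow> x \<in> N" "inv x \<in> M \<longleftrightarrow> x \<in> M"
    using x normal_facts(3)[OF N, of x] normal_facts(3)[OF N, of "inv x"] normal_facts(3)[OF M, of x] normal_facts(3)[OF M, of "inv x"] by auto
  ultimately show ?thesis using x by (simp split: if_splits)
qed

section \<open>Conjugacy classes\<close>

lemma conj_class_self: "g \<in> carrier G \<Longrightarrow> g \<in> conj_class G g"
  unfolding conj_class_def by (rule CollectI, rule exI[of _ \<one>]) simp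

lemma conj_class_subset: "g \<in> carrier G \<Longrightarrow> conj_class G g \<subseteq> carrier G"
  unfolding conj_class_def by auto

lemma class_function_conj_class:
  "class_function f \<Longrightarrow> g \<in> carrier G \<Longrightarrow> h \<in> conj_class G g \<Longrightarrow> f h = f g"
  unfolding conj_class_def class_function_def by auto

lemma conj_class_conj:
  assumes g: "g \<in> carrier G" and x: "x \<in> carrier G"
  shows "conj_class G (x \<otimes> g \<otimes> inv x) = conj_class G g"
proof -
  have *: "conj_class G (x \<otimes> g \<otimes> inv x) \<subseteq> conj_class G g" if "g \<in> carrier G" "x \<in> carrier G" for g x
  proof
    fix y assume "y \<in> conj_class G (x \<otimes> g \<otimes> inv x)"
    then obtain z where z: "z \<in> carrier G" "y = z \<otimes> (x \<otimes> g \<otimes> inv x) \<otimes> inv z" unfolding conj_class_def by blast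
    then have "y = (z \<otimes> x) \<otimes> g \<otimes> inv (z \<otimes> x)" using that by (simp add: inv_mult_group m_assoc)
    then show "y \<in> conj_class G g" using z that unfolding conj_class_def by blast
  qed
  have "conj_class G (inv x \<otimes> (x \<otimes> g \<otimes> inv x) \<otimes> inv (inv x)) \<subseteq> conj_class G (x \<otimes> g \<otimes> inv x)"
    using g x by (intro *) auto
  moreover have "inv x \<otimes> (x \<otimes> g \<otimes> inv x) \<otimes> inv (inv x) = g"
    using g x by (simp add: m_assoc[symmetric]) (simp add: m_assoc)
  ultimately show ?thesis using *[OF g x] by auto
qed

lemma conj_class_eq:
  assumes "g \<in> carrier G" "h \<in> conj_class G g"
  shows "conj_class G h = conj_class G g"
proof -
  obtain x where "x \<in> carrier G" "h = x \<otimes> g \<otimes> inv x" using assms(2) unfolding conj_class_def by blast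
  then show ?thesis using conj_class_conj[OF assms(1)] by simp
qed

lemma class_function_class_indicator: "class_function (\<lambda>x. if x \<in> conj_class G g then a else b)"
  if g: "g \<in> carrier G"
proof -
  have "x \<otimes> y \<otimes> inv x \<in> conj_class G g \<longleftrightarrow> y \<in> conj_class G g"
    if x: "x \<in> carrier G" and y: "y \<in> carrier G" for x y
  proof -
    have z: "x \<otimes> y \<otimes> inv x \<in> carrier G" using x y by simp
    show ?thesis
      using conj_class_conj[OF y x] conj_class_eq[OF g, of y] conj_class_eq[OF g, of "x \<otimes> y \<otimes> inv x"]
        conj_class_self[OF y] conj_class_self[OF z] by metis
  qed
  then show ?thesis unfolding class_function_def by simp
qed

lemma conj_class_normal:
  "N \<lhd> G \<Longrightarrow> g \<in> carrier G \<Longrightarrow> h \<in> conj_class G g \<Longrightarrow> h \<in> N \<longleftrightarrow> g \<in> N"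
  unfolding conj_class_def using normal_conj_iff by auto

lemma conj_class_card: "g \<in> carrier G \<Longrightarrow> finite (conj_class G g) \<and> card (conj_class G g) > 0"
  using finite_subset[OF conj_class_subset fin, of g] conj_class_self[of g]
  by (auto simp: card_gt_0_iff)

lemma conj_class_sum:
  assumes g: "g \<in> carrier G" and \<theta>: "class_function \<theta>"
  shows "(\<Sum>x\<in>conj_class G g. \<theta> x) = of_nat (card (conj_class G g)) * \<theta> g"
proof -
  have "(\<Sum>x\<in>conj_class G g. \<theta> x) = (\<Sum>x\<in>conj_class G g. \<theta> g)"
    using class_function_conj_class[OF \<theta> g] by (intro sum.cong) auto
  then show ?thesis by simp
qed

lemma mult_normal_outside:
  assumes N: "N \<lhd> G" and g: "g \<in> carrier G" "g \<notin> N" and x: "x \<in> N"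
  shows "g \<otimes> x \<notin> N"
proof
  assume "g \<otimes> x \<in> N"
  then have "(g \<otimes> x) \<otimes> inv x \<in> N" using normal_facts(3,4)[OF N] x by blast
  then show False using g normal_facts(2)[OF N x] by (simp add: m_assoc)
qed

section \<open>Characters of quotient groups\<close>

lemma quotient_finite_group:
  assumes "N \<lhd> G"
  shows "finite_group (G Mod N)"
proof -
  interpret normal N G by (rule assms)
  show ?thesis
    by (intro finite_group.intro finite_group_axioms.intro factorgroup_is_group)
      (simp add: FactGroup_def RCOSETS_def fin)
qed

lemma quotient_simps:
  assumes N: "N \<lhd> G"
  shows "carrier (G Mod N) = (\<lambda>g. N #> g) ` carrier G"
    and "g \<in> carrier G \<Longrightarrow> h \<in> carrier G \<Longrightarrow> (N #> g) \<otimes>\<^bsub>G Mod N\<^esub> (N #> h) = N #> (g \<otimes> h)"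
    and "\<one>\<^bsub>G Mod N\<^esub> = N #> \<one>"
proof -
  interpret normal N G by (rule N)
  show "carrier (G Mod N) = (\<lambda>g. N #> g) ` carrier G" by (auto simp: FactGroup_def RCOSETS_def)
  show "g \<in> carrier G \<Longrightarrow> h \<in> carrier G \<Longrightarrow> (N #> g) \<otimes>\<^bsub>G Mod N\<^esub> (N #> h) = N #> (g \<otimes> h)"
    by (simp add: FactGroup_def rcos_sum)
  show "\<one>\<^bsub>G Mod N\<^esub> = N #> \<one>" using coset_mult_one[OF subset] by (simp add: FactGroup_def)
qed

lemma quotient_coset_mem: "N \<lhd> G \<Longrightarrow> g \<in> carrier G \<Longrightarrow> N #> g \<in> carrier (G Mod N)"
  using quotient_simps(1) by blast

text \<open>Both sides speak of the same matrices, hence of the same invariant subspaces.\<close>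

lemma irreducible_inflate_iff:
  assumes N: "N \<lhd> G" and eq: "\<And>g. g \<in> carrier G \<Longrightarrow> \<rho> g = \<rho>' (N #> g)"
  shows "irreducible_representation G n \<rho> \<longleftrightarrow> irreducible_representation (G Mod N) n \<rho>'"
proof -
  interpret Q: finite_group "G Mod N" by (rule quotient_finite_group[OF N])
  note qc = quotient_simps(1)[OF N]
  have "representation G n \<rho> \<longleftrightarrow> representation (G Mod N) n \<rho>'"
    unfolding representation_iff Q.representation_iff qc
    using eq quotient_simps(2,3)[OF N] by simp
  moreover have "invariant_subspace G n \<rho> W \<longleftrightarrow> invariant_subspace (G Mod N) n \<rho>' W" for W
    unfolding invariant_subspace_def qc using eq by simp
  ultimately show ?thesis unfolding irreducible_iff Q.irreducible_iff by simp
qed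

definition inflate where
  "inflate N \<phi> = (\<lambda>g\<in>carrier G. \<phi> (N #> g))"

lemma inflate_rep_character:
  assumes N: "N \<lhd> G" and eq: "\<And>g. g \<in> carrier G \<Longrightarrow> \<rho> g = \<rho>' (N #> g)"
  shows "inflate N (rep_character (G Mod N) \<rho>') = rep_character G \<rho>"
  unfolding inflate_def rep_character_def
  using eq quotient_coset_mem[OF N] by (intro restrict_ext) simp

lemma coset_of_normal_mem:
  assumes N: "N \<lhd> G" and x: "x \<in> N"
  shows "N #> x = N #> \<one>"
proof -
  interpret normal N G by (rule N)
  show ?thesis using rcos_const[OF is_group x] coset_mult_one[OF subset] by simp
qed

lemma inflate_inj: "N \<lhd> G \<Longrightarrow> inj_on (inflate N) (Irr (G Mod N))"
proof (rule inj_onI)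
  fix \<phi> \<phi>' assume N: "N \<lhd> G" and "\<phi> \<in> Irr (G Mod N)" "\<phi>' \<in> Irr (G Mod N)" and eq: "inflate N \<phi> = inflate N \<phi>'"
  then have ext: "\<phi> \<in> extensional (carrier (G Mod N))" "\<phi>' \<in> extensional (carrier (G Mod N))"
    unfolding Irr_def rep_character_def by auto
  show "\<phi> = \<phi>'"
  proof (rule extensionalityI[OF ext])
    fix C assume "C \<in> carrier (G Mod N)"
    then obtain g where g: "g \<in> carrier G" "C = N #> g" using quotient_simps(1)[OF N] by blast
    then show "\<phi> C = \<phi>' C" using fun_cong[OF eq, of g] unfolding inflate_def by simp
  qed
qed

lemma inflate_char_ker:
  assumes N: "N \<lhd> G" and S: "S \<subseteq> carrier G"
  shows "(\<lambda>g. N #> g) ` S \<subseteq> char_ker (G Mod N) \<phi> \<longleftrightarrow> S \<subseteq> char_ker G (inflate N \<phi>)"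
  unfolding char_ker_def inflate_def
  using S quotient_coset_mem[OF N] quotient_simps(3)[OF N] by auto

text \<open>A representation whose kernel contains \<open>N\<close> is constant on the cosets of \<open>N\<close> and therefore factors
  through the quotient.\<close>

lemma inflate_Irr:
  assumes N: "N \<lhd> G"
  shows "inflate N ` Irr (G Mod N) = {\<chi> \<in> Irr G. N \<subseteq> char_ker G \<chi>}"
proof
  show "inflate N ` Irr (G Mod N) \<subseteq> {\<chi> \<in> Irr G. N \<subseteq> char_ker G \<chi>}"
  proof
    fix \<chi> assume "\<chi> \<in> inflate N ` Irr (G Mod N)"
    then obtain n \<rho>' where \<rho>': "irreducible_representation (G Mod N) n \<rho>'"
      and \<chi>: "\<chi> = inflate N (rep_character (G Mod N) \<rho>')" unfolding Irr_def by blast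
    have "irreducible_representation G n (\<lambda>g. \<rho>' (N #> g))"
      using irreducible_inflate_iff[OF N, of "\<lambda>g. \<rho>' (N #> g)" \<rho>'] \<rho>' by simp
    moreover have "\<chi> = rep_character G (\<lambda>g. \<rho>' (N #> g))"
      unfolding \<chi> by (rule inflate_rep_character[OF N]) simp
    ultimately have irr: "\<chi> \<in> Irr G" unfolding Irr_def by blast
    have "x \<in> char_ker G \<chi>" if x: "x \<in> N" for x
      unfolding \<chi> char_ker_def inflate_def using coset_of_normal_mem[OF N x] normal_facts(2)[OF N x] by simp
    then show "\<chi> \<in> {\<chi> \<in> Irr G. N \<subseteq> char_ker G \<chi>}" using irr by blast
  qed
  show "{\<chi> \<in> Irr G. N \<subseteq> char_ker G \<chi>} \<subseteq> inflate N ` Irr (G Mod N)"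
  proof
    fix \<chi> assume "\<chi> \<in> {\<chi> \<in> Irr G. N \<subseteq> char_ker G \<chi>}"
    then have \<chi>: "\<chi> \<in> Irr G" "N \<subseteq> char_ker G \<chi>" by auto
    obtain n \<rho> where irr: "irreducible_representation G n \<rho>" and \<rho>: "representation G n \<rho>"
      and \<chi>\<rho>: "\<chi> = rep_character G \<rho>"
      using \<chi>(1) by (rule IrrE) blast
    have ker: "\<rho> x = 1\<^sub>m n" if "x \<in> N" for x
      using char_ker_eq_rep_kernel[OF \<rho>] \<chi>(2) that unfolding \<chi>\<rho> by blast
    \<comment> \<open>The choice of the coset representative is immaterial, as \<open>\<rho>\<close> is trivial on \<open>N\<close>.\<close>
    define \<rho>' where "\<rho>' C = \<rho> (SOME g. g \<in> carrier G \<and> C = N #> g)" for C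
    have eq: "\<rho> g = \<rho>' (N #> g)" if g: "g \<in> carrier G" for g
    proof -
      define h where "h = (SOME h. h \<in> carrier G \<and> N #> g = N #> h)"
      have h: "h \<in> carrier G" "N #> g = N #> h"
        unfolding h_def using someI_ex[of "\<lambda>h. h \<in> carrier G \<and> N #> g = N #> h"] g by blast+
      interpret normal N G by (rule N)
      have "g \<in> N #> h" using rcos_self[OF g subgroup_axioms] h(2) by simp
      then obtain x where x: "x \<in> N" "g = x \<otimes> h" unfolding r_coset_def by blast
      have "\<rho> g = \<rho> h"
        using x h repD(2)[OF \<rho> normal_facts(2)[OF N x(1)] h(1)] ker[OF x(1)] repD(1)[OF \<rho> h(1)] by simp
      then show ?thesis unfolding \<rho>'_def h_def .
    qed
    have "irreducible_representation (G Mod N) n \<rho>'"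
      using irreducible_inflate_iff[OF N, of \<rho> \<rho>' n] eq irr by blast
    then have "rep_character (G Mod N) \<rho>' \<in> Irr (G Mod N)" unfolding Irr_def by blast
    moreover have "\<chi> = inflate N (rep_character (G Mod N) \<rho>')"
      unfolding \<chi>\<rho> by (rule inflate_rep_character[OF N, symmetric]) (rule eq)
    ultimately show "\<chi> \<in> inflate N ` Irr (G Mod N)" by blast
  qed
qed

lemma card_Irr_rel_quotient:
  assumes N: "N \<lhd> G" and M: "M \<lhd> G"
  shows "card (Irr_rel (G Mod N) (carrier ((G\<lparr>carrier := M\<rparr>) Mod N))) = card (irr_between N M)"
proof -
  have MG: "M \<subseteq> carrier G" by (rule normal_facts(6)[OF M])
  have car: "carrier ((G\<lparr>carrier := M\<rparr>) Mod N) = (\<lambda>g. N #> g) ` M"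
    unfolding FactGroup_def RCOSETS_def r_coset_def by auto
  have "bij_betw (inflate N) (Irr_rel (G Mod N) ((\<lambda>g. N #> g) ` M)) (irr_between N M)"
    unfolding bij_betw_def
  proof
    show "inj_on (inflate N) (Irr_rel (G Mod N) ((\<lambda>g. N #> g) ` M))"
      using inflate_inj[OF N] unfolding Irr_rel_def by (rule inj_on_subset) blast
    have "irr_between N M = {\<chi> \<in> inflate N ` Irr (G Mod N). \<not> M \<subseteq> char_ker G \<chi>}"
      unfolding inflate_Irr[OF N] irr_between_def by blast
    also have "\<dots> = inflate N ` Irr_rel (G Mod N) ((\<lambda>g. N #> g) ` M)"
      unfolding Irr_rel_def inflate_char_ker[OF N MG] by blast
    finally show "inflate N ` Irr_rel (G Mod N) ((\<lambda>g. N #> g) ` M) = irr_between N M" by simp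
  qed
  then show ?thesis unfolding car by (rule bij_betw_same_card)
qed

section \<open>Normal subgroups whose difference is a conjugacy class\<close>

text \<open>The coset \<open>gN\<close> lies in \<open>M - N\<close>, hence in the class of \<open>g\<close>. So \<open>\<psi>\<close> is constant on \<open>gN\<close>, where its
  sum is \<open>0\<close>.\<close>

lemma single_class_vanishing:
  assumes N: "N \<lhd> G" and M: "M \<lhd> G" and NM: "N \<subset> M" and g: "g \<in> M - N" and cl: "conj_class G g = M - N"
    and \<psi>: "\<psi> \<in> Irr_rel G N"
  shows "\<psi> g = 0"
proof -
  have \<psi>I: "\<psi> \<in> Irr G" "\<not> N \<subseteq> char_ker G \<psi>" using \<psi> unfolding Irr_rel_def by auto
  have gG: "g \<in> carrier G" "g \<notin> N" using g normal_facts(2)[OF M] by auto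
  have "\<psi> (g \<otimes> x) = \<psi> g" if x: "x \<in> N" for x
  proof (rule class_function_conj_class[OF irr_class_function[OF \<psi>I(1)] gG(1)])
    show "g \<otimes> x \<in> conj_class G g"
      unfolding cl using normal_facts(4)[OF M, of g x] g x NM mult_normal_outside[OF N gG x] by blast
  qed
  then have "of_nat (card N) * \<psi> g = (\<Sum>x\<in>N. \<psi> (g \<otimes> x))" by simp
  also have "\<dots> = 0" by (rule normal_coset_sum_eq_0[OF N \<psi>I gG(1)])
  finally show ?thesis using normal_facts(8)[OF N] by simp
qed

text \<open>The first of the three equivalent conditions, expressed by characters of \<open>G\<close> itself and with
  its witnesses named. The other two conditions are both compared with it.\<close>

definition single_class_and_character where
  "single_class_and_character N M g \<chi> \<longleftrightarrow>
     M \<lhd> G \<and> N \<subset> M \<and> g \<in> M - N \<and> conj_class G g = M - N \<and> irr_between N M = {\<chi>}"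

lemma vanishing_character_of_single_class:
  assumes N: "N \<lhd> G" and S: "single_class_and_character N M g \<chi>"
  shows "g \<in> carrier G - N" "\<chi> \<in> Irr G" "N \<subseteq> char_ker G \<chi>"
    "\<And>h. h \<in> carrier G \<Longrightarrow> conj_class G h \<subseteq> carrier G - N \<Longrightarrow> conj_class G h \<noteq> conj_class G g \<Longrightarrow>
       vanishes_on \<chi> (conj_class G h)"
    "\<And>\<psi>. \<psi> \<in> Irr_rel G N \<Longrightarrow> \<psi> g = 0"
proof -
  have M: "M \<lhd> G" "N \<subset> M" "g \<in> M - N" "conj_class G g = M - N" "irr_between N M = {\<chi>}"
    using S unfolding single_class_and_character_def by auto
  show g: "g \<in> carrier G - N" using M normal_facts(2)[OF M(1)] by blast
  show \<chi>: "\<chi> \<in> Irr G" "N \<subseteq> char_ker G \<chi>" using M(5) unfolding irr_between_def by auto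
  show "vanishes_on \<chi> (conj_class G h)"
    if h: "h \<in> carrier G" "conj_class G h \<subseteq> carrier G - N" "conj_class G h \<noteq> conj_class G g" for h
    unfolding vanishes_on_def
  proof
    fix x assume x: "x \<in> conj_class G h"
    have xG: "x \<in> carrier G" "x \<notin> N" using x h(2) by auto
    have "x \<notin> M"
    proof
      assume "x \<in> M"
      then have "x \<in> conj_class G g" using M(4) xG by blast
      then show False using conj_class_eq[OF h(1) x] conj_class_eq[of g x] g h(3) by simp
    qed
    then have "\<chi> \<one> * \<chi> x = 0" using unique_irr_between_values[OF N M(1,2,5) xG(1)] xG by simp
    then show "\<chi> x = 0" using irr_one_neq_0[OF \<chi>(1)] by simp
  qed
  show "\<psi> g = 0" if "\<psi> \<in> Irr_rel G N" for \<psi>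
    by (rule single_class_vanishing[OF N M(1-4) that])
qed

text \<open>A character that does not vanish on the class \<open>M - N\<close> is nonzero at \<open>g\<close>, so its kernel contains
  \<open>N\<close>; if its kernel does not contain \<open>M - N\<close>, it is one of the characters between \<open>N\<close> and \<open>M\<close>.\<close>

lemma unique_character_of_single_class:
  assumes N: "N \<lhd> G" and S: "single_class_and_character N M g \<chi>"
  shows "\<exists>!\<chi>. \<chi> \<in> Irr G \<and> \<not> vanishes_on \<chi> (M - N) \<and> \<not> M - N \<subseteq> char_ker G \<chi>"
proof -
  have M: "M \<lhd> G" "N \<subset> M" "g \<in> M - N" "conj_class G g = M - N" "irr_between N M = {\<chi>}"
    using S unfolding single_class_and_character_def by auto
  have gG: "g \<in> carrier G" using M normal_facts(2)[OF M(1)] by blast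
  have \<chi>: "\<chi> \<in> Irr G" "N \<subseteq> char_ker G \<chi>" "\<not> M \<subseteq> char_ker G \<chi>" using M(5) unfolding irr_between_def by auto
  show ?thesis
  proof (rule ex1I[of _ \<chi>])
    have "\<chi> g \<noteq> 0"
      using unique_irr_between_values[OF N M(1,2,5) gG] M(3) normal_facts(8)[OF M(1)] normal_facts(8)[OF normal_carrier]
      by auto
    then show "\<chi> \<in> Irr G \<and> \<not> vanishes_on \<chi> (M - N) \<and> \<not> M - N \<subseteq> char_ker G \<chi>"
      using \<chi> M(3) unfolding vanishes_on_def by blast
    fix \<theta> assume \<theta>: "\<theta> \<in> Irr G \<and> \<not> vanishes_on \<theta> (M - N) \<and> \<not> M - N \<subseteq> char_ker G \<theta>"
    then have "\<theta> g \<noteq> 0"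
      using class_function_conj_class[OF irr_class_function gG, of \<theta>] unfolding M(4)[symmetric] vanishes_on_def by auto
    then have "\<theta> \<notin> Irr_rel G N" using vanishing_character_of_single_class(5)[OF N S] by blast
    then have "\<theta> \<in> irr_between N M" using \<theta> unfolding Irr_rel_def irr_between_def by auto
    then show "\<theta> = \<chi>" using M(5) by simp
  qed
qed

text \<open>Only the elements of \<open>N\<close> and of the class of \<open>g\<close> contribute to the orthogonality relation of \<open>\<psi>\<close>
  and \<open>\<theta>\<close>, and the summand is constant on either set.\<close>

lemma vanishing_character_orthogonality:
  assumes N: "N \<lhd> G" and g: "g \<in> carrier G - N" and \<psi>: "\<psi> \<in> Irr G" "N \<subseteq> char_ker G \<psi>"
    and van: "\<And>x. x \<in> carrier G - N \<Longrightarrow> x \<notin> conj_class G g \<Longrightarrow> \<psi> x = 0"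
    and \<theta>: "\<theta> \<in> Irr G" "N \<subseteq> char_ker G \<theta>" "\<theta> \<noteq> \<psi>"
  shows "of_nat (card N) * \<psi> \<one> * \<theta> \<one> + of_nat (card (conj_class G g)) * \<psi> g * \<theta> (inv g) = 0"
proof -
  let ?C = "conj_class G g"
  have gG: "g \<in> carrier G" using g by simp
  have disj: "N \<inter> ?C = {}" using conj_class_normal[OF N gG] g by blast
  have sub: "N \<union> ?C \<subseteq> carrier G" using normal_facts(6)[OF N] conj_class_subset[OF gG] by blast
  have cf: "class_function (\<lambda>x. \<theta> (inv x))"
    by (rule class_function_inv[OF irr_class_function[OF \<theta>(1)]])
  have "0 = (\<Sum>x\<in>carrier G. \<psi> x * \<theta> (inv x))" using row_orthogonality[OF \<psi>(1) \<theta>(1)] \<theta>(3) by simp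
  also have "\<dots> = (\<Sum>x\<in>N \<union> ?C. \<psi> x * \<theta> (inv x))"
    using van sub fin by (intro sum.mono_neutral_right) auto
  also have "\<dots> = (\<Sum>x\<in>N. \<psi> x * \<theta> (inv x)) + (\<Sum>x\<in>?C. \<psi> x * \<theta> (inv x))"
    using disj normal_facts(7)[OF N] conj_class_card[OF gG] by (intro sum.union_disjoint) auto
  also have "(\<Sum>x\<in>N. \<psi> x * \<theta> (inv x)) = (\<Sum>x\<in>N. \<psi> \<one> * \<theta> \<one>)"
  proof (rule sum.cong[OF refl])
    fix x assume "x \<in> N"
    then have "\<psi> x = \<psi> \<one>" "\<theta> (inv x) = \<theta> \<one>" using char_kerD \<psi>(2) \<theta>(2) normal_facts(3)[OF N] by blast+
    then show "\<psi> x * \<theta> (inv x) = \<psi> \<one> * \<theta> \<one>" by simp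
  qed
  also have "(\<Sum>x\<in>?C. \<psi> x * \<theta> (inv x)) = (\<Sum>x\<in>?C. \<psi> g * \<theta> (inv g))"
    using class_function_conj_class[OF irr_class_function[OF \<psi>(1)] gG] class_function_conj_class[OF cf gG]
    by (intro sum.cong) auto
  finally show ?thesis by (simp add: mult.assoc)
qed

text \<open>If \<open>\<chi>\<close> is trivial, the vanishing condition says that \<open>G - N\<close> is the class of \<open>g\<close>. It then holds
  for every character, and \<open>G/N\<close> has a nontrivial irreducible one because \<open>N \<noteq> G\<close>.\<close>

lemma nontrivial_vanishing_character:
  assumes N: "N \<lhd> G" and g: "g \<in> carrier G - N" and \<chi>: "\<chi> \<in> Irr G" "N \<subseteq> char_ker G \<chi>"
    and van: "\<And>x. x \<in> carrier G - N \<Longrightarrow> x \<notin> conj_class G g \<Longrightarrow> \<chi> x = 0"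
  obtains \<psi> where "\<psi> \<in> Irr G" "N \<subseteq> char_ker G \<psi>" "\<psi> \<noteq> trivial_char"
    "\<And>x. x \<in> carrier G - N \<Longrightarrow> x \<notin> conj_class G g \<Longrightarrow> \<psi> x = 0"
proof (cases "\<chi> = trivial_char")
  case True
  then have all: "x \<in> conj_class G g" if "x \<in> carrier G - N" for x
    using van[OF that] that trivial_char_apply[of x] by auto
  have "N \<subset> carrier G" using g normal_facts(6)[OF N] by blast
  from irr_between_nonempty[OF N normal_carrier this] obtain \<psi> where "\<psi> \<in> irr_between N (carrier G)" by blast
  then have "\<psi> \<in> Irr G" "N \<subseteq> char_ker G \<psi>" "\<psi> \<noteq> trivial_char"
    unfolding irr_between_def using char_ker_trivial_char by auto
  then show thesis using all that by blast
qed (use that \<chi> van in blast)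

text \<open>Take \<open>M\<close> as the intersection of the kernels of all irreducible characters of \<open>G/N\<close> other than the
  nontrivial character \<open>\<psi>\<close> that vanishes outside \<open>N\<close> and the class of \<open>g\<close>. Comparing the orthogonality
  relation of \<open>\<psi>\<close> with the trivial character to that with such a character \<open>\<theta>\<close> gives
  \<open>\<theta>(g\<^sup>-\<^sup>1) = \<theta>(\<one>)\<close>, so \<open>g \<in> M\<close>. By construction \<open>\<psi>\<close> is the only character between \<open>N\<close> and \<open>M\<close>;
  it is therefore nonzero throughout \<open>M - N\<close>, which leaves no room for a second class.\<close>

lemma single_class_of_vanishing_character:
  assumes N: "N \<lhd> G" and g: "g \<in> carrier G - N" and \<chi>: "\<chi> \<in> Irr G" "N \<subseteq> char_ker G \<chi>"
    and van: "\<And>h. h \<in> carrier G \<Longrightarrow> conj_class G h \<subseteq> carrier G - N \<Longrightarrow> conj_class G h \<noteq> conj_class G g \<Longrightarrow>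
       vanishes_on \<chi> (conj_class G h)"
  shows "\<exists>M \<psi>. single_class_and_character N M g \<psi>"
proof -
  have gG: "g \<in> carrier G" using g by simp
  have van': "\<chi> x = 0" if x: "x \<in> carrier G - N" "x \<notin> conj_class G g" for x
  proof -
    have xG: "x \<in> carrier G" using x by simp
    have "conj_class G x \<subseteq> carrier G - N" using conj_class_subset[OF xG] conj_class_normal[OF N xG] x by blast
    moreover have "conj_class G x \<noteq> conj_class G g" using conj_class_self[OF xG] x by blast
    ultimately show ?thesis using van[OF xG] conj_class_self[OF xG] unfolding vanishes_on_def by blast
  qed
  obtain \<psi> where \<psi>: "\<psi> \<in> Irr G" "N \<subseteq> char_ker G \<psi>" "\<psi> \<noteq> trivial_char"
    "\<And>x. x \<in> carrier G - N \<Longrightarrow> x \<notin> conj_class G g \<Longrightarrow> \<psi> x = 0"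
    using nontrivial_vanishing_character[OF N g \<chi> van'] by metis
  let ?C = "of_nat (card (conj_class G g)) :: complex"
  have rel: "of_nat (card N) * \<psi> \<one> * \<theta> \<one> + ?C * \<psi> g * \<theta> (inv g) = 0"
    if "\<theta> \<in> Irr G" "N \<subseteq> char_ker G \<theta>" "\<theta> \<noteq> \<psi>" for \<theta>
    by (rule vanishing_character_orthogonality[OF N g \<psi>(1,2) _ that]) (rule \<psi>(4))
  have "N \<subseteq> char_ker G trivial_char" using char_ker_trivial_char normal_facts(6)[OF N] by simp
  from rel[OF trivial_char_irr this \<psi>(3)[symmetric]]
  have t: "of_nat (card N) * \<psi> \<one> + ?C * \<psi> g = 0" using gG by (simp add: trivial_char_apply)
  then have nz: "?C * \<psi> g \<noteq> 0" using irr_one_neq_0[OF \<psi>(1)] normal_facts(8)[OF N] conj_class_card[OF gG] by auto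
  have gker: "g \<in> char_ker G \<theta>" if \<theta>: "\<theta> \<in> Irr G" "N \<subseteq> char_ker G \<theta>" "\<theta> \<noteq> \<psi>" for \<theta>
  proof -
    have "of_nat (card N) * \<psi> \<one> * \<theta> \<one> + ?C * \<psi> g * \<theta> (inv g) = 0" by (rule rel[OF \<theta>])
    moreover have "of_nat (card N) * \<psi> \<one> = - (?C * \<psi> g)" using t by (simp add: eq_neg_iff_add_eq_0)
    ultimately have "(?C * \<psi> g) * (\<theta> (inv g) - \<theta> \<one>) = 0" by (simp add: algebra_simps)
    then have "\<theta> (inv g) = \<theta> \<one>" using nz by simp
    then have "inv g \<in> char_ker G \<theta>" unfolding char_ker_def using gG by simp
    then show ?thesis using normal_facts(3)[OF char_ker_normal[OF \<theta>(1)], of "inv g"] gG by simp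
  qed
  define M where "M = {x \<in> carrier G. \<forall>\<theta>\<in>Irr G. N \<subseteq> char_ker G \<theta> \<and> \<theta> \<noteq> \<psi> \<longrightarrow> x \<in> char_ker G \<theta>}"
  have M: "M \<lhd> G"
    unfolding normal_inv_iff
  proof (intro conjI ballI)
    show "subgroup M G"
    proof (rule subgroupI)
      show "M \<noteq> {}" unfolding M_def using normal_facts(1)[OF char_ker_normal] by blast
      show "inv a \<in> M" if "a \<in> M" for a
        using that normal_facts(3)[OF char_ker_normal] unfolding M_def by auto
      show "a \<otimes> b \<in> M" if "a \<in> M" "b \<in> M" for a b
        using that normal_facts(4)[OF char_ker_normal] unfolding M_def by auto
    qed (auto simp: M_def)
    show "x \<otimes> h \<otimes> inv x \<in> M" if "x \<in> carrier G" "h \<in> M" for x h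
      using that normal_facts(5)[OF char_ker_normal] unfolding M_def by auto
  qed
  have gM: "g \<in> M - N" unfolding M_def using g gker by blast
  have NM: "N \<subset> M" using gM normal_facts(6)[OF N] unfolding M_def by blast
  have "irr_between N M \<subseteq> {\<psi>}" unfolding irr_between_def M_def by blast
  then have only: "irr_between N M = {\<psi>}" using irr_between_nonempty[OF N M NM] by blast
  have "conj_class G g = M - N"
  proof
    show "conj_class G g \<subseteq> M - N" using conj_class_normal[OF M gG] conj_class_normal[OF N gG] gM by blast
    show "M - N \<subseteq> conj_class G g"
    proof
      fix x assume x: "x \<in> M - N"
      then have xG: "x \<in> carrier G" using normal_facts(2)[OF M] by blast
      have "\<psi> \<one> * \<psi> x \<noteq> 0"
        using unique_irr_between_values[OF N M NM only xG] x normal_facts(8)[OF M] normal_facts(8)[OF normal_carrier] by auto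
      then show "x \<in> conj_class G g" using \<psi>(4)[of x] x xG by auto
    qed
  qed
  then have "single_class_and_character N M g \<psi>"
    unfolding single_class_and_character_def using M NM gM only by blast
  then show ?thesis by blast
qed

text \<open>An element \<open>x\<close> of \<open>N\<close> is the product of \<open>g\<^sup>-\<^sup>1\<close> and \<open>gx\<close>, and \<open>gx\<close> lies in \<open>M - N\<close>.\<close>

lemma normal_complement_generates:
  assumes N: "N \<lhd> G" and K: "K \<lhd> G" and g: "g \<in> M - N" and M: "M \<lhd> G" "N \<subset> M" and sub: "M - N \<subseteq> K"
  shows "M \<subseteq> K"
proof
  fix x assume x: "x \<in> M"
  show "x \<in> K"
  proof (cases "x \<in> N")
    case True
    have gG: "g \<in> carrier G" "g \<notin> N" using g normal_facts(2)[OF M(1)] by auto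
    have xG: "x \<in> carrier G" using x normal_facts(2)[OF M(1)] by blast
    have "g \<otimes> x \<in> M - N" using mult_normal_outside[OF N gG True] normal_facts(4)[OF M(1), of g x] g x by blast
    then have "inv g \<otimes> (g \<otimes> x) \<in> K" using sub g normal_facts(3,4)[OF K] by blast
    then show ?thesis using gG xG by (simp add: m_assoc[symmetric])
  qed (use x sub in blast)
qed

text \<open>All irreducible characters other than \<open>\<chi>\<close> are constant on \<open>M - N\<close>. If \<open>g\<close> and \<open>h\<close> in
  \<open>M - N\<close> were not conjugate, the difference of the suitably scaled indicators of their classes
  would be orthogonal to all these characters, hence a multiple of \<open>x \<mapsto> \<chi>(x\<^sup>-\<^sup>1)\<close>. As it vanishes at
  \<open>\<one>\<close> and \<open>\<chi>(\<one>) \<noteq> 0\<close>, it would be \<open>0\<close>. So \<open>M - N\<close> is a single class. Since \<open>\<chi>\<close> does not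
  vanish on it, \<open>N\<close> lies in the kernel of \<open>\<chi>\<close>. A character \<open>\<theta>\<close> between \<open>N\<close> and \<open>M\<close> cannot vanish on
  \<open>M - N\<close>, because its sum over \<open>M\<close> is \<open>0\<close> while its sum over \<open>N\<close> is not; so \<open>\<theta> = \<chi>\<close>.\<close>

lemma single_class_of_unique_character:
  assumes N: "N \<lhd> G" and M: "M \<lhd> G" and NM: "N \<subset> M"
    and ex1: "\<exists>!\<chi>. \<chi> \<in> Irr G \<and> \<not> vanishes_on \<chi> (M - N) \<and> \<not> M - N \<subseteq> char_ker G \<chi>"
  shows "\<exists>g \<chi>. single_class_and_character N M g \<chi>"
proof -
  obtain \<chi> where \<chi>: "\<chi> \<in> Irr G" "\<not> vanishes_on \<chi> (M - N)" "\<not> M - N \<subseteq> char_ker G \<chi>"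
    and uniq: "\<And>\<theta>. \<theta> \<in> Irr G \<Longrightarrow> \<not> vanishes_on \<theta> (M - N) \<Longrightarrow> \<not> M - N \<subseteq> char_ker G \<theta> \<Longrightarrow> \<theta> = \<chi>"
    using ex1 by (elim ex1E) blast
  obtain g where g: "g \<in> M - N" using NM by blast
  have gG: "g \<in> carrier G" "g \<notin> N" using g normal_facts(2)[OF M] by auto
  have const: "\<theta> h = \<theta> g" if \<theta>: "\<theta> \<in> Irr G" "\<theta> \<noteq> \<chi>" and h: "h \<in> M - N" for \<theta> h
  proof (cases "vanishes_on \<theta> (M - N)")
    case True
    then show ?thesis using g h unfolding vanishes_on_def by simp
  next
    case False
    then have "M - N \<subseteq> char_ker G \<theta>" using uniq[OF \<theta>(1)] \<theta>(2) by blast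
    then show ?thesis by (metis char_kerD g h subsetD)
  qed
  have cl: "conj_class G g = M - N"
  proof
    show "conj_class G g \<subseteq> M - N" using conj_class_normal[OF M gG(1)] conj_class_normal[OF N gG(1)] g by blast
    show "M - N \<subseteq> conj_class G g"
    proof (rule subsetI, rule ccontr)
      fix h assume h: "h \<in> M - N" and nh: "h \<notin> conj_class G g"
      have hG: "h \<in> carrier G" using h normal_facts(2)[OF M] by blast
      let ?Cg = "conj_class G g" and ?Ch = "conj_class G h"
      let ?f = "\<lambda>x. (if x \<in> ?Cg then of_nat (card ?Ch) else 0) - (if x \<in> ?Ch then of_nat (card ?Cg) else 0) :: complex"
      have fsum: "(\<Sum>x\<in>carrier G. ?f x * \<theta> x) = of_nat (card ?Ch) * of_nat (card ?Cg) * (\<theta> g - \<theta> h)"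
        if "class_function \<theta>" for \<theta>
        using indicator_sum[OF conj_class_subset[OF gG(1)], of "of_nat (card ?Ch)" \<theta>]
          indicator_sum[OF conj_class_subset[OF hG], of "of_nat (card ?Cg)" \<theta>]
          conj_class_sum[OF gG(1) that] conj_class_sum[OF hG that]
        by (simp add: left_diff_distrib right_diff_distrib sum_subtractf)
      \<comment> \<open>The constant that makes \<open>?F\<close> below orthogonal to \<open>\<chi>\<close> as well.\<close>
      define c where "c = (\<Sum>x\<in>carrier G. ?f x * \<chi> x) / of_nat (card (carrier G))"
      let ?F = "\<lambda>x. ?f x - c * \<chi> (inv x)"
      have F0: "?F x = 0" if x: "x \<in> carrier G" for x
      proof (rule orthogonal_class_function[OF _ _ x])
        show "class_function ?F"
          using class_function_class_indicator[OF gG(1), of "of_nat (card ?Ch)" 0]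
            class_function_class_indicator[OF hG, of "of_nat (card ?Cg)" 0]
            class_function_inv[OF irr_class_function[OF \<chi>(1)]]
          unfolding class_function_def by simp
        fix \<theta> assume \<theta>: "\<theta> \<in> Irr G"
        have "(\<Sum>x\<in>carrier G. ?F x * \<theta> x) = (\<Sum>x\<in>carrier G. ?f x * \<theta> x) - c * (\<Sum>x\<in>carrier G. \<theta> x * \<chi> (inv x))"
          unfolding sum_distrib_left sum_subtractf[symmetric]
          by (intro sum.cong refl) (simp only: left_diff_distrib, simp only: mult_ac)
        also have "\<dots> = 0"
        proof (cases "\<theta> = \<chi>")
          case True
          then show ?thesis using row_orthogonality[OF \<chi>(1) \<chi>(1)] normal_facts(8)[OF normal_carrier] unfolding c_def by simp
        next
          case False
          then show ?thesis using row_orthogonality[OF \<theta> \<chi>(1)] fsum[OF irr_class_function[OF \<theta>]] const[OF \<theta> False h] by simp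
        qed
        finally show "(\<Sum>x\<in>carrier G. ?F x * \<theta> x) = 0" .
      qed
      have one: "\<one> \<notin> ?Cg" "\<one> \<notin> ?Ch"
        using conj_class_normal[OF N gG(1), of \<one>] conj_class_normal[OF N hG, of \<one>] normal_facts(1)[OF N] g h by auto
      have "c = 0" using F0[OF one_closed] one irr_one_neq_0[OF \<chi>(1)] by simp
      moreover have "g \<notin> ?Ch" using conj_class_eq[OF hG, of g] conj_class_self[OF hG] nh by blast
      ultimately have "of_nat (card ?Ch) = (0::complex)" using F0[OF gG(1)] conj_class_self[OF gG(1)] by simp
      then show False using conj_class_card[OF hG] by simp
    qed
  qed
  have \<chi>g: "\<chi> g \<noteq> 0"
    using \<chi>(2) class_function_conj_class[OF irr_class_function[OF \<chi>(1)] gG(1)] unfolding cl[symmetric] vanishes_on_def by auto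
  have N\<chi>: "N \<subseteq> char_ker G \<chi>"
  proof (rule ccontr)
    assume "\<not> N \<subseteq> char_ker G \<chi>"
    then have "\<chi> \<in> Irr_rel G N" using \<chi>(1) unfolding Irr_rel_def by simp
    then show False using single_class_vanishing[OF N M NM g cl] \<chi>g by blast
  qed
  have "\<theta> = \<chi>" if \<theta>: "\<theta> \<in> irr_between N M" for \<theta>
  proof (rule uniq)
    have \<theta>I: "\<theta> \<in> Irr G" "N \<subseteq> char_ker G \<theta>" "\<not> M \<subseteq> char_ker G \<theta>" using \<theta> unfolding irr_between_def by auto
    show "\<theta> \<in> Irr G" by (rule \<theta>I)
    show "\<not> M - N \<subseteq> char_ker G \<theta>"
      using normal_complement_generates[OF N char_ker_normal[OF \<theta>I(1)] g M NM] \<theta>I(3) by blast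
    show "\<not> vanishes_on \<theta> (M - N)"
    proof
      assume v: "vanishes_on \<theta> (M - N)"
      have "(\<Sum>x\<in>M. \<theta> x) = (\<Sum>x\<in>N. \<theta> x)"
        using v NM normal_facts(7)[OF M] unfolding vanishes_on_def by (intro sum.mono_neutral_right) auto
      then show False
        using normal_sum[OF M \<theta>I(1)] normal_sum[OF N \<theta>I(1)] \<theta>I normal_facts(8)[OF N] irr_one_neq_0[OF \<theta>I(1)] by simp
    qed
  qed
  then have "irr_between N M = {\<chi>}" using irr_between_nonempty[OF N M NM] by blast
  then have "single_class_and_character N M g \<chi>"
    unfolding single_class_and_character_def using M NM g cl by blast
  then show ?thesis by blast
qed

end

theorem theorem4:
  fixes G :: "('a, 'b) monoid_scheme" and N :: "'a set"
  assumes "group G" and "finite (carrier G)" and "N \<lhd> G"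
  shows
    "((\<exists>M g. M \<lhd> G \<and> N \<subset> M \<and> g \<in> M - N \<and> conj_class G g = M - N \<and>
         card (Irr_rel (G Mod N) (carrier ((G\<lparr>carrier := M\<rparr>) Mod N))) = 1)
      \<longleftrightarrow>
      (\<exists>g \<in> carrier G - N. \<exists>\<chi> \<in> Irr G. N \<subseteq> char_ker G \<chi> \<and>
         (\<forall>h \<in> carrier G. conj_class G h \<subseteq> carrier G - N \<and> conj_class G h \<noteq> conj_class G g
            \<longrightarrow> vanishes_on \<chi> (conj_class G h)) \<and>
         (\<forall>\<psi> \<in> Irr_rel G N. \<psi> g = 0)))
     \<and>
     ((\<exists>g \<in> carrier G - N. \<exists>\<chi> \<in> Irr G. N \<subseteq> char_ker G \<chi> \<and>
         (\<forall>h \<in> carrier G. conj_class G h \<subseteq> carrier G - N \<and> conj_class G h \<noteq> conj_class G g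
            \<longrightarrow> vanishes_on \<chi> (conj_class G h)) \<and>
         (\<forall>\<psi> \<in> Irr_rel G N. \<psi> g = 0))
      \<longleftrightarrow>
      (\<exists>M. M \<lhd> G \<and> N \<subset> M \<and>
         (\<exists>!\<chi>. \<chi> \<in> Irr G \<and> \<not> vanishes_on \<chi> (M - N) \<and> \<not> M - N \<subseteq> char_ker G \<chi>)))"
    (is "(?one \<longleftrightarrow> ?two) \<and> (?two \<longleftrightarrow> ?three)")
proof -
  interpret finite_group G using assms(1,2) by (intro finite_group.intro finite_group_axioms.intro)
  note N = \<open>N \<lhd> G\<close>
  let ?S = "\<exists>M g \<chi>. single_class_and_character N M g \<chi>"
  have one: "?one \<longleftrightarrow> ?S"
  proof -
    have "M \<lhd> G \<and> N \<subset> M \<and> g \<in> M - N \<and> conj_class G g = M - N \<and>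
         card (Irr_rel (G Mod N) (carrier ((G\<lparr>carrier := M\<rparr>) Mod N))) = 1 \<longleftrightarrow>
         (\<exists>\<chi>. single_class_and_character N M g \<chi>)" for M g
      unfolding single_class_and_character_def
      using card_Irr_rel_quotient[OF N, of M] card_1_singleton_iff[of "irr_between N M"] by auto
    then show ?thesis by simp
  qed
  have two: "?two \<longleftrightarrow> ?S"
  proof
    assume ?S
    then obtain M g \<chi> where S: "single_class_and_character N M g \<chi>" by blast
    note v = vanishing_character_of_single_class[OF N S]
    show ?two
      by (rule bexI[OF _ v(1)], rule bexI[OF _ v(2)]) (use v(3-5) in blast)
  next
    assume ?two
    then obtain g \<chi> where g: "g \<in> carrier G - N" and \<chi>: "\<chi> \<in> Irr G" "N \<subseteq> char_ker G \<chi>"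
      and van: "\<forall>h \<in> carrier G. conj_class G h \<subseteq> carrier G - N \<and> conj_class G h \<noteq> conj_class G g
            \<longrightarrow> vanishes_on \<chi> (conj_class G h)" by blast
    have "\<exists>M \<psi>. single_class_and_character N M g \<psi>"
      by (rule single_class_of_vanishing_character[OF N g \<chi>]) (use van in blast)
    then show ?S by blast
  qed
  have three: "?three \<longleftrightarrow> ?S"
  proof
    assume ?S
    then obtain M g \<chi> where S: "single_class_and_character N M g \<chi>" by blast
    then have "M \<lhd> G" "N \<subset> M" unfolding single_class_and_character_def by auto
    then show ?three using unique_character_of_single_class[OF N S] by blast
  next
    assume ?three
    then obtain M where "M \<lhd> G" "N \<subset> M"
      and "\<exists>!\<chi>. \<chi> \<in> Irr G \<and> \<not> vanishes_on \<chi> (M - N) \<and> \<not> M - N \<subseteq> char_ker G \<chi>" by blast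
    from single_class_of_unique_character[OF N this] show ?S by blast
  qed
  show ?thesis unfolding one two three by simp
qed
end
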